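(* Let $a,b,c\in\mathbb{R}$ be such that either $c=0$ and $b\neq a$, or $c>0$ and $b>a$. Let $Q(\nu)=a\nu(\nu-1)+b\nu+c$, let $\nu_0$ be the largest root of $Q$, and let $\overline{\nu}=\max\{0,\nu_0\}$. Suppose that $\nu\geq\overline{\nu}$ and that the following inequalities are valid: $$Q(\nu)+4a\nu+2a+2b>0,\qquad (4\nu+3)Q(\nu)>4a\nu+2a+2b.$$ Then the function $$z\mapsto \frac{2^{\nu}\Gamma(\nu+1)}{Q(\nu)}z^{1-\frac{\nu}{2}}\left(azJ_{\nu}''(\sqrt{z})+b\sqrt{z}J_{\nu}'(\sqrt{z})+cJ_{\nu}(\sqrt{z})\right)$$ is starlike in $\mathbb{D}$ and all of its derivatives are close-to-convex (and hence univalent) in $\mathbb{D}$ if and only if $\nu\geq\nu^{\circ}$, where $\nu^{\circ}$ is the unique root on $(\overline{\nu},\infty)$ of the equation (in the unknown $\nu$) $$(2a\nu^2-2a\nu+2b\nu-3a-b+2c)J_{\nu}(1)=(a\nu^2+a\nu-b\nu-3a+2b+c)J_{\nu+1}(1).$$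
   Context: $\mathbb{D}=\{z\in\mathbb{C}:|z|<1\}$ is the open unit disk. The Bessel function of the first kind is $J_\nu(z)=\sum_{n\ge0}\frac{(-1)^n}{n!\,\Gamma(n+\nu+1)}\left(\frac z2\right)^{2n+\nu}$, and $J_\nu'$, $J_\nu''$ are its first and second derivatives with respect to $z$; $J_\nu'(\sqrt z)$, $J_\nu''(\sqrt z)$ mean these derivatives evaluated at $\sqrt z$. The displayed function is understood as the entire function of $z$ given by its power series (the fractional powers cancel), which has the form $z+O(z^2)$ at $0$. An analytic function $f$ on $\mathbb{D}$ with $f(0)=0$ is starlike in $\mathbb{D}$ if it is univalent there and $f(\mathbb{D})$ is starlike with respect to the origin. An analytic function $h$ on $\mathbb{D}$ (not necessarily normalized) is close-to-convex in $\mathbb{D}$ if there is a univalent function $\varphi$ on $\mathbb{D}$ with convex image such that $\operatorname{Re}(h'(z)/\varphi'(z))>0$ for all $z\in\mathbb{D}$.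
   Formalization: For c>0 the existence of a root of the equation on (ν̄,∞) is assumed, since it can fail (e.g. a=0, b=1, c=1000), leaving ν° undefined; uniqueness is proved, and for c=0 existence too. If Q has no real root, ν̄ is taken as 0. *)

theory Defs
  imports "HOL-Complex_Analysis.Complex_Analysis"
begin

text \<open>
  Principal branches are used throughout.  Since \<^term>\<open>(0 :: complex) powr s = 0\<close> for every
  \<^term>\<open>s\<close>, this function takes the value 0 instead of 1 at the origin when the order is 0;
  below, its value at the origin only occurs multiplied by 0.
\<close>

definition bessel_J :: "real \<Rightarrow> complex \<Rightarrow> complex" where
  "bessel_J \<nu> z =
     (\<Sum>n. (-1) ^ n / (fact n * Gamma (of_nat n + of_real \<nu> + 1))
            * (z / 2) powr (2 * of_nat n + of_real \<nu>))"

definition Q_poly :: "real \<Rightarrow> real \<Rightarrow> real \<Rightarrow> real \<Rightarrow> real" where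
  "Q_poly a b c \<nu> = a * \<nu> * (\<nu> - 1) + b * \<nu> + c"

text \<open>
  If \<^term>\<open>c > 0\<close> and \<^term>\<open>0 < a\<close>, \<^term>\<open>a < b\<close>, the quadratic may have no real root.  Its complex
  roots then have negative real part, and the value of the maximum is taken to be 0, as it is
  when the roots are real (and then necessarily negative).
\<close>

definition nu_bar :: "real \<Rightarrow> real \<Rightarrow> real \<Rightarrow> real" where
  "nu_bar a b c =
     (if \<exists>x. Q_poly a b c x = 0 then max 0 (Max {x. Q_poly a b c x = 0}) else 0)"

definition bessel_combination :: "real \<Rightarrow> real \<Rightarrow> real \<Rightarrow> real \<Rightarrow> complex \<Rightarrow> complex" where
  "bessel_combination a b c \<nu> z =
     2 powr of_real \<nu> * Gamma (of_real \<nu> + 1) / of_real (Q_poly a b c \<nu>)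
     * z powr (1 - of_real \<nu> / 2)
     * (of_real a * z * (deriv ^^ 2) (bessel_J \<nu>) (csqrt z)
        + of_real b * csqrt z * deriv (bessel_J \<nu>) (csqrt z)
        + of_real c * bessel_J \<nu> (csqrt z))"

definition starlike_in_disk :: "(complex \<Rightarrow> complex) \<Rightarrow> bool" where
  "starlike_in_disk f \<longleftrightarrow>
     f holomorphic_on ball 0 1 \<and> f 0 = 0 \<and> inj_on f (ball 0 1) \<and>
     (\<forall>w\<in>f ` ball 0 1. closed_segment 0 w \<subseteq> f ` ball 0 1)"

definition close_to_convex_in_disk :: "(complex \<Rightarrow> complex) \<Rightarrow> bool" where
  "close_to_convex_in_disk h \<longleftrightarrow>
     h holomorphic_on ball 0 1 \<and>
     (\<exists>\<phi>. \<phi> holomorphic_on ball 0 1 \<and> inj_on \<phi> (ball 0 1) \<and> convex (\<phi> ` ball 0 1) \<and>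
          (\<forall>z\<in>ball 0 1. Re (deriv h z / deriv \<phi> z) > 0))"

text \<open>
  This equation always has a root beyond \<^const>\<open>nu_bar\<close> when the inequalities of the theorem hold
  and \<^term>\<open>c = 0\<close>, but not necessarily when \<^term>\<open>c > 0\<close>: for \<^term>\<open>a = 0\<close>, \<^term>\<open>b = 1\<close>,
  \<^term>\<open>c = 1000\<close> there is none on the whole half-line of nonnegative orders.
\<close>

definition threshold_equation :: "real \<Rightarrow> real \<Rightarrow> real \<Rightarrow> real \<Rightarrow> bool" where
  "threshold_equation a b c \<nu> \<longleftrightarrow>
     of_real (2 * a * \<nu>\<^sup>2 - 2 * a * \<nu> + 2 * b * \<nu> - 3 * a - b + 2 * c) * bessel_J \<nu> 1
   = of_real (a * \<nu>\<^sup>2 + a * \<nu> - b * \<nu> - 3 * a + 2 * b + c) * bessel_J (\<nu> + 1) 1"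


text \<open>
  With these conventions the fractional powers in \<^const>\<open>bessel_combination\<close> cancel at every point
  of the plane, including the branch cut and the origin, so that it is literally the entire
  function given by its power series.
\<close>

lemma summable_div_fact:
  fixes h :: "nat \<Rightarrow> complex"
  assumes "\<And>n. norm (h n) \<le> C * B ^ n / fact n"
  shows "summable (\<lambda>n. h n * w ^ n)"
proof (rule summable_comparison_test')
  show "summable (\<lambda>n. C * ((B * norm w) ^ n / fact n))"
    using summable_exp_generic[of "B * norm w"] by (intro summable_mult) (simp add: field_simps)
  show "norm (h n * w ^ n) \<le> C * ((B * norm w) ^ n / fact n)" for n
    using mult_right_mono[OF assms[of n], of "norm w ^ n"]
    by (simp add: norm_mult norm_power power_mult_distrib mult_ac)
qed

lemma Gamma_ge_aux:
  fixes \<nu> :: real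
  assumes "\<nu> \<ge> 0"
  shows "Gamma (real n + \<nu> + 1) \<ge> Gamma (\<nu> + 1)"
proof (induction n)
  case (Suc n)
  have "Gamma (real (Suc n) + \<nu> + 1) = (real n + \<nu> + 1) * Gamma (real n + \<nu> + 1)"
    using assms Gamma_plus1[of "real n + \<nu> + 1"] by (auto simp: add_ac nonpos_Ints_def)
  moreover have "1 * Gamma (real n + \<nu> + 1) \<le> (real n + \<nu> + 1) * Gamma (real n + \<nu> + 1)"
    using assms by (intro mult_right_mono) (auto intro!: Gamma_real_nonneg)
  ultimately show ?case using Suc by linarith
qed simp

definition J_coeff :: "real \<Rightarrow> nat \<Rightarrow> complex" where
  "J_coeff \<nu> n = (-1) ^ n / (fact n * Gamma (of_nat n + of_real \<nu> + 1) * 4 ^ n)"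

lemma J_coeff_bound:
  assumes "\<nu> \<ge> 0"
  shows "norm (J_coeff \<nu> n) \<le> (1 / Gamma (\<nu> + 1)) * 1 ^ n / fact n"
proof -
  have g: "Gamma (of_nat n + of_real \<nu> + 1 :: complex) = of_real (Gamma (real n + \<nu> + 1))"
    by (metis Gamma_complex_of_real of_real_1 of_real_add of_real_of_nat_eq)
  have p: "Gamma (\<nu> + 1) > 0" using assms by (intro Gamma_real_pos) auto
  have "fact n * Gamma (\<nu> + 1) * 1 \<le> fact n * Gamma (real n + \<nu> + 1) * (4::real) ^ n"
    using Gamma_ge_aux[OF assms, of n] p by (intro mult_mono) auto
  hence "1 / (fact n * Gamma (real n + \<nu> + 1) * (4::real) ^ n) \<le> 1 / (fact n * Gamma (\<nu> + 1))"
    using p by (intro divide_left_mono) (auto intro!: mult_pos_pos less_le_trans[OF p Gamma_ge_aux[OF assms]])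
  moreover have "Gamma (real n + \<nu> + 1) > 0" using Gamma_ge_aux[OF assms, of n] p by linarith
  ultimately show ?thesis
    unfolding J_coeff_def g by (simp add: norm_divide norm_mult norm_power mult_ac)
qed

lemma deriv_powr_series:
  fixes h :: "nat \<Rightarrow> complex" and s :: complex
  assumes sm: "\<And>w. summable (\<lambda>n. h n * w ^ n)" and w: "w \<notin> \<real>\<^sub>\<le>\<^sub>0"
  shows "((\<lambda>w. w powr s * (\<Sum>n. h n * w ^ (2 * n))) has_field_derivative
          w powr (s - 1) * (\<Sum>n. (2 * of_nat n + s) * h n * w ^ (2 * n))) (at w)"
    and "summable (\<lambda>n. (2 * of_nat n + s) * h n * x ^ n)"
proof -
  define H where "H = (\<lambda>x. \<Sum>n. h n * x ^ n)"
  define H' where "H' = (\<lambda>x. \<Sum>n. diffs h n * x ^ n)"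
  have dH: "(H has_field_derivative H' x) (at x)" for x
    unfolding H_def H'_def using termdiffs_strong_converges_everywhere[OF sm] .
  have sd: "summable (\<lambda>n. diffs h n * x ^ n)" for x
    using termdiff_converges_all[OF sm] .
  have sn: "(\<lambda>n. of_nat n * h n * x ^ n) sums (x * H' x)" for x
  proof -
    have "(\<lambda>n. of_nat n * h n * x ^ (n - Suc 0)) sums H' x"
      unfolding H'_def using diffs_equiv[OF sd] .
    hence "(\<lambda>n. x * (of_nat n * h n * x ^ (n - Suc 0))) sums (x * H' x)" by (rule sums_mult)
    moreover have "x * (of_nat n * h n * x ^ (n - Suc 0)) = of_nat n * h n * x ^ n" for n
      by (cases n) auto
    ultimately show ?thesis by simp
  qed
  have s0: "(\<lambda>n. h n * x ^ n) sums H x" for x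
    unfolding H_def using sm by (rule summable_sums)
  have st: "(\<lambda>n. (2 * of_nat n + s) * h n * x ^ n) sums (2 * (x * H' x) + s * H x)" for x
    using sums_add[OF sums_mult[OF sn, of 2] sums_mult[OF s0, of s]]
    by (simp add: algebra_simps)
  show "summable (\<lambda>n. (2 * of_nat n + s) * h n * x ^ n)" using st by (rule sums_summable)
  have w0: "w \<noteq> 0" using w by auto
  have pw: "w powr s = w powr (s - 1) * w"
    using w0 by (simp add: powr_diff)
  have d2: "((\<lambda>w. H (w ^ 2)) has_field_derivative H' (w ^ 2) * (2 * w)) (at w)"
    by (rule DERIV_chain2[OF dH]) (auto intro!: derivative_eq_intros)
  have "((\<lambda>w. w powr s * H (w ^ 2)) has_field_derivative
          s * w powr (s - 1) * H (w ^ 2) + H' (w ^ 2) * (2 * w) * w powr s) (at w)"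
    using DERIV_mult[OF has_field_derivative_powr[OF w] d2] by (simp add: mult_ac)
  also have "s * w powr (s - 1) * H (w ^ 2) + H' (w ^ 2) * (2 * w) * w powr s
      = w powr (s - 1) * (2 * (w ^ 2 * H' (w ^ 2)) + s * H (w ^ 2))"
    unfolding pw by (simp add: algebra_simps power2_eq_square)
  also have "2 * (w ^ 2 * H' (w ^ 2)) + s * H (w ^ 2)
      = (\<Sum>n. (2 * of_nat n + s) * h n * w ^ (2 * n))"
    using sums_unique[OF st[of "w ^ 2"]] by (simp add: power_mult)
  finally show "((\<lambda>w. w powr s * (\<Sum>n. h n * w ^ (2 * n))) has_field_derivative
          w powr (s - 1) * (\<Sum>n. (2 * of_nat n + s) * h n * w ^ (2 * n))) (at w)"
    by (simp add: H_def power_mult)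
qed

lemma summable_J_coeff:
  assumes "\<nu> \<ge> 0"
  shows "summable (\<lambda>n. J_coeff \<nu> n * w ^ n)"
  using summable_div_fact[OF J_coeff_bound[OF assms]] .

lemma bessel_J_eq:
  assumes "\<nu> \<ge> 0" "w \<noteq> 0"
  shows "bessel_J \<nu> w = (1 / 2) powr of_real \<nu> *
           (w powr of_real \<nu> * (\<Sum>n. J_coeff \<nu> n * w ^ (2 * n)))"
proof -
  have sm: "summable (\<lambda>n. J_coeff \<nu> n * w ^ (2 * n))"
    using summable_J_coeff[OF assms(1), of "w ^ 2"] by (simp add: power_mult)
  have wh: "(w / 2) powr s = (1 / 2) powr s * w powr s" for s
    using powr_times_real_left[of "1 / 2" w s] by simp
  have t: "(w / 2) powr (2 * of_nat n + of_real \<nu>)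
      = (1 / 2) powr of_real \<nu> * w powr of_real \<nu> * (w ^ (2 * n) / 4 ^ n)" for n
  proof -
    have "(w / 2) powr (2 * of_nat n + of_real \<nu>) = (w / 2) powr of_nat (2 * n) * (w / 2) powr of_real \<nu>"
      using powr_add[of "w / 2" "of_nat (2 * n)" "of_real \<nu>"] by simp
    also have "(w / 2) powr of_nat (2 * n) = (w / 2) ^ (2 * n)"
      using assms(2) by (intro powr_complexpow) auto
    also have "\<dots> = w ^ (2 * n) / 4 ^ n"
      by (simp add: power_divide power_mult)
    finally show ?thesis by (simp add: wh)
  qed
  have "bessel_J \<nu> w = (\<Sum>n. ((1 / 2) powr of_real \<nu> * w powr of_real \<nu>) * (J_coeff \<nu> n * w ^ (2 * n)))"
    unfolding bessel_J_def t by (intro suminf_cong) (simp add: J_coeff_def)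
  also have "\<dots> = ((1 / 2) powr of_real \<nu> * w powr of_real \<nu>) * (\<Sum>n. J_coeff \<nu> n * w ^ (2 * n))"
    using sm by (rule suminf_mult)
  finally show ?thesis by (simp add: mult.assoc)
qed

lemma deriv_cong_off_cut:
  assumes "\<And>w. w \<notin> \<real>\<^sub>\<le>\<^sub>0 \<Longrightarrow> f w = g w" "(g has_field_derivative D) (at w)" "w \<notin> \<real>\<^sub>\<le>\<^sub>0"
  shows "deriv f w = (D :: complex)"
proof -
  have "(f has_field_derivative D) (at w)"
    using assms by (intro has_field_derivative_transform_within_open[OF assms(2), of "- \<real>\<^sub>\<le>\<^sub>0"])
      (auto simp: open_Compl)
  thus ?thesis by (rule DERIV_imp_deriv)
qed

lemma deriv_bessel_J:
  assumes nu: "\<nu> \<ge> 0" and w: "w \<notin> \<real>\<^sub>\<le>\<^sub>0"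
  shows "deriv (bessel_J \<nu>) w = (1 / 2) powr of_real \<nu> *
           (w powr (of_real \<nu> - 1) *
            (\<Sum>n. (2 * of_nat n + of_real \<nu>) * J_coeff \<nu> n * w ^ (2 * n)))"
proof (rule deriv_cong_off_cut[OF _ _ w])
  show "bessel_J \<nu> w = (1 / 2) powr of_real \<nu> *
           (w powr of_real \<nu> * (\<Sum>n. J_coeff \<nu> n * w ^ (2 * n)))" if "w \<notin> \<real>\<^sub>\<le>\<^sub>0" for w
    using that by (intro bessel_J_eq[OF nu]) auto
qed (intro DERIV_cmult deriv_powr_series(1) summable_J_coeff nu w)

lemma deriv2_bessel_J:
  assumes nu: "\<nu> \<ge> 0" and w: "w \<notin> \<real>\<^sub>\<le>\<^sub>0"
  shows "(deriv ^^ 2) (bessel_J \<nu>) w = (1 / 2) powr of_real \<nu> *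
           (w powr (of_real \<nu> - 1 - 1) *
            (\<Sum>n. (2 * of_nat n + (of_real \<nu> - 1)) *
                  ((2 * of_nat n + of_real \<nu>) * J_coeff \<nu> n) * w ^ (2 * n)))"
proof -
  have "deriv (deriv (bessel_J \<nu>)) w = (1 / 2) powr of_real \<nu> *
           (w powr (of_real \<nu> - 1 - 1) *
            (\<Sum>n. (2 * of_nat n + (of_real \<nu> - 1)) *
                  ((2 * of_nat n + of_real \<nu>) * J_coeff \<nu> n) * w ^ (2 * n)))"
    using DERIV_cmult[OF deriv_powr_series(1)
        [OF deriv_powr_series(2)[OF summable_J_coeff[OF nu] w, of "of_real \<nu>"] w, of "of_real \<nu> - 1"]]
    by (intro deriv_cong_off_cut[OF deriv_bessel_J[OF nu] _ w])
  thus ?thesis by (simp add: numeral_2_eq_2)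
qed

theorem bessel_combination_power_series:
  assumes nu: "\<nu> \<ge> 0"
  shows "(\<lambda>n. of_real (Gamma (\<nu> + 1) * Q_poly a b c (2 * real n + \<nu>) / Q_poly a b c \<nu>)
               * J_coeff \<nu> n * z ^ (n + 1)) sums bessel_combination a b c \<nu> z"
proof (cases "z = 0")
  case True
  thus ?thesis by (simp add: bessel_combination_def)
next
  case False
  define w where "w = csqrt z"
  have z: "z = w ^ 2" by (simp add: w_def)
  have w0: "w \<noteq> 0" using False by (auto simp: w_def)
  have w: "w \<notin> \<real>\<^sub>\<le>\<^sub>0"
    using csqrt_principal[of z] w0 unfolding w_def
    by (auto simp: complex_nonpos_Reals_iff complex_eq_iff)
  define S where "S = (\<lambda>k. \<Sum>n. k n * J_coeff \<nu> n * z ^ n)"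
  define k1 where "k1 = (\<lambda>n. 2 * of_nat n + complex_of_real \<nu>)"
  define k2 where "k2 = (\<lambda>n. (2 * of_nat n + (complex_of_real \<nu> - 1)) * k1 n)"
  note sm0 = summable_J_coeff[OF nu]
  note sm1 = deriv_powr_series(2)[OF sm0 w, of "of_real \<nu>"]
  note sm2 = deriv_powr_series(2)[OF sm1 w, of "of_real \<nu> - 1"]
  have s0: "(\<lambda>n. 1 * J_coeff \<nu> n * z ^ n) sums S (\<lambda>_. 1)"
    unfolding S_def using sm0 by (intro summable_sums) simp
  have s1: "(\<lambda>n. k1 n * J_coeff \<nu> n * z ^ n) sums S k1"
    unfolding S_def k1_def using sm1 by (intro summable_sums)
  have s2: "(\<lambda>n. k2 n * J_coeff \<nu> n * z ^ n) sums S k2"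
    unfolding S_def k1_def k2_def using sm2 by (intro summable_sums) (simp add: mult.assoc)
  let ?h = "(1 / 2 :: complex) powr of_real \<nu>" and ?w = "w powr of_real \<nu>"
  have e0: "bessel_J \<nu> w = ?h * ?w * S (\<lambda>_. 1)"
    using bessel_J_eq[OF nu w0] by (simp add: S_def z power_mult mult.assoc)
  have e1: "w * deriv (bessel_J \<nu>) w = ?h * ?w * S k1"
    using deriv_bessel_J[OF nu w] w0
    by (simp add: S_def z power_mult k1_def powr_diff mult.assoc)
  have e2: "w ^ 2 * (deriv ^^ 2) (bessel_J \<nu>) w = ?h * ?w * S k2"
    unfolding deriv2_bessel_J[OF nu w] using w0
    by (simp add: S_def z power_mult k1_def k2_def powr_diff power2_eq_square mult.assoc)
  have pz: "z powr (1 - of_real \<nu> / 2) * ?w = z"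
  proof -
    have "?w = z powr (of_real \<nu> / 2)"
    proof -
      have "Ln w = Ln z / 2"
        unfolding w_def csqrt_exp_Ln[OF False]
        using Im_Ln_le_pi[OF False] mpi_less_Im_Ln[OF False] by (intro Ln_exp) auto
      hence "Ln z = 2 * Ln w" by (metis mult.commute nonzero_divide_eq_eq zero_neq_numeral)
      thus ?thesis using w0 False by (simp add: powr_def)
    qed
    thus ?thesis using False powr_add[of z "1 - of_real \<nu> / 2" "of_real \<nu> / 2"] by simp
  qed
  have ph: "2 powr of_real \<nu> * ?h = 1"
    using powr_times_real_left[of 2 "1/2" "of_real \<nu>"] by simp
  define K :: complex where "K = of_real (Gamma (\<nu> + 1) / Q_poly a b c \<nu>)"
  define T where "T = of_real a * S k2 + of_real b * S k1 + of_real c * S (\<lambda>_. 1)"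
  have "bessel_combination a b c \<nu> z =
      2 powr of_real \<nu> * K * z powr (1 - of_real \<nu> / 2) *
      (of_real a * (w ^ 2 * (deriv ^^ 2) (bessel_J \<nu>) w) + of_real b * (w * deriv (bessel_J \<nu>) w)
       + of_real c * bessel_J \<nu> w)"
    unfolding bessel_combination_def w_def[symmetric] K_def
    using Gamma_complex_of_real[of "\<nu> + 1"] by (simp add: z mult.assoc)
  also have "\<dots> = (2 powr of_real \<nu> * ?h) * (z powr (1 - of_real \<nu> / 2) * ?w) * (K * T)"
    unfolding e0 e1 e2 T_def by (simp add: algebra_simps)
  also have "\<dots> = z * (K * T)" by (simp add: pz ph)
  finally have eq: "bessel_combination a b c \<nu> z = z * (K * T)" .
  have "(\<lambda>n. z * (K * (of_real a * (k2 n * J_coeff \<nu> n * z ^ n) + of_real b * (k1 n * J_coeff \<nu> n * z ^ n)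
            + of_real c * (1 * J_coeff \<nu> n * z ^ n)))) sums (z * (K * T))"
    unfolding T_def by (intro sums_mult sums_add s0 s1 s2)
  also have "(\<lambda>n. z * (K * (of_real a * (k2 n * J_coeff \<nu> n * z ^ n) + of_real b * (k1 n * J_coeff \<nu> n * z ^ n)
            + of_real c * (1 * J_coeff \<nu> n * z ^ n)))) =
      (\<lambda>n. of_real (Gamma (\<nu> + 1) * Q_poly a b c (2 * real n + \<nu>) / Q_poly a b c \<nu>)
               * J_coeff \<nu> n * z ^ (n + 1))"
  proof
    fix n
    have "complex_of_real (Q_poly a b c (2 * real n + \<nu>)) = of_real a * k2 n + of_real b * k1 n + of_real c"
      by (simp add: Q_poly_def k1_def k2_def algebra_simps)
    thus "z * (K * (of_real a * (k2 n * J_coeff \<nu> n * z ^ n) + of_real b * (k1 n * J_coeff \<nu> n * z ^ n)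
            + of_real c * (1 * J_coeff \<nu> n * z ^ n))) =
          of_real (Gamma (\<nu> + 1) * Q_poly a b c (2 * real n + \<nu>) / Q_poly a b c \<nu>)
               * J_coeff \<nu> n * z ^ (n + 1)"
      unfolding K_def by (simp add: algebra_simps add_divide_distrib)
  qed
  finally show ?thesis unfolding eq .
qed

end

theory Submission
  imports Defs
begin

text \<open>
  Write \<open>f(z) = z G(z)\<close> for the entire function of the theorem.  Three independent facts make the
  statement true.

  \<^item> \<^emph>\<open>The derivatives are always close-to-convex.\<close>  For \<open>k \<ge> 1\<close> the Taylor coefficients of
    \<open>f\<^sup>(\<^sup>k\<^sup>+\<^sup>1\<^sup>)\<close> decay so fast that \<open>f\<^sup>(\<^sup>k\<^sup>+\<^sup>1\<^sup>)\<close> stays in a disk around its value at the origin which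
    misses the origin.  Hence \<open>f\<^sup>(\<^sup>k\<^sup>)\<close> is close-to-convex with respect to a linear function,
    and injective (\<open>derivatives_close_to_convex\<close>).

  \<^item> \<^emph>\<open>Starlikeness is equivalent to \<open>f'(1) \<ge> 0\<close>.\<close>  If \<open>f\<close> is injective, the real function \<open>f'\<close> has
    no zero on \<open>[0,1)\<close> and \<open>f'(0) = 1\<close>, so \<open>f'(1) \<ge> 0\<close>.  Conversely,
    \<open>z f'(z) / f(z) = 1 - z L(z)\<close> with \<open>L = -G'/G\<close>, and the heart of the argument is that all Taylor
    coefficients of \<open>L\<close> are nonnegative (\<open>log_decay_combination_fps\<close>).  This replaces the
    reality of the zeros of \<open>G\<close>, of which these coefficients are the inverse power sums.  It
    comes from the recurrence of the Bessel functions, which turns the quotient of two consecutive ones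
    into a continued fraction with positive terms, and it survives the passage to the combination.
    Nonnegativity gives \<open>\<bar>L(z)\<bar> \<le> L(1) = -G'(1)/G(1)\<close>, and \<open>f'(1) = G(1) + G'(1) \<ge> 0\<close> makes this at
    most 1, so that \<open>z f'(z) / f(z)\<close> has positive real part.  The two inequalities of the theorem say that
    \<open>0 < Q(\<nu> + 2) < 4 (\<nu> + 1) Q(\<nu>)\<close>; they are what keeps \<open>G\<close> positive on \<open>[0,1]\<close>.

  \<^item> \<^emph>\<open>The sign of \<open>f'(1)\<close> changes exactly once, at the root of the threshold equation.\<close>  Up to a positive
    factor, \<open>f'(1)\<close> is an explicit expression in \<open>\<nu>\<close> and \<open>q(\<nu>) = J\<^bsub>\<nu>+1\<^esub>(1) / J\<^bsub>\<nu>\<^esub>(1)\<close>, namely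
    the difference of the two sides of the threshold equation divided by \<open>J\<^bsub>\<nu>\<^esub>(1)\<close>.  Divided
    further by \<open>2 - q(\<nu>) > 0\<close> it becomes strictly increasing beyond \<open>\<nu>\<close>-bar.  Everything needed about \<open>q\<close>
    (monotonicity, a Lipschitz bound, continuity) follows from \<open>0 < q \<le> 1\<close> and the recurrence
    \<open>q(\<nu>) (2 (\<nu> + 1) - q(\<nu> + 1)) = 1\<close>, by iterating it for two different orders.

  The hypotheses leave two shapes of \<open>Q\<close> (\<open>parameter_cases\<close>): either its coefficients with respect to
  \<open>1\<close>, \<open>\<mu>\<close>, \<open>\<mu>\<^sup>2\<close> are all nonnegative and \<open>\<nu>\<close>-bar is 0, or \<open>Q(\<mu>) = a \<mu> (\<mu> - s)\<close> with \<open>a > 0\<close> and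
  \<open>s > 0\<close>, and \<open>\<nu>\<close>-bar is \<open>s\<close>.
\<close>

section \<open>Positivity of logarithmic derivatives of formal power series\<close>

definition nonneg_fps :: "complex fps \<Rightarrow> bool" where
  "nonneg_fps F \<longleftrightarrow> (\<forall>n. fps_nth F n \<in> \<real>\<^sub>\<ge>\<^sub>0)"

lemma nonneg_fpsI: "(\<And>n. fps_nth F n \<in> \<real>\<^sub>\<ge>\<^sub>0) \<Longrightarrow> nonneg_fps F"
  by (simp add: nonneg_fps_def)

lemma nonneg_fpsD: "nonneg_fps F \<Longrightarrow> fps_nth F n \<in> \<real>\<^sub>\<ge>\<^sub>0"
  by (simp add: nonneg_fps_def)

lemma nonneg_Reals_sum: "(\<And>i. i \<in> A \<Longrightarrow> f i \<in> \<real>\<^sub>\<ge>\<^sub>0) \<Longrightarrow> sum f A \<in> (\<real>\<^sub>\<ge>\<^sub>0 :: complex set)"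
  by (induction A rule: infinite_finite_induct) auto

lemma nonneg_fps_add: "nonneg_fps F \<Longrightarrow> nonneg_fps G \<Longrightarrow> nonneg_fps (F + G)"
  by (simp add: nonneg_fps_def)

lemma nonneg_fps_mult: "nonneg_fps F \<Longrightarrow> nonneg_fps G \<Longrightarrow> nonneg_fps (F * G)"
  unfolding nonneg_fps_def fps_mult_nth by (auto intro!: nonneg_Reals_sum)

lemma nonneg_fps_X: "nonneg_fps fps_X"
  by (simp add: nonneg_fps_def fps_X_def)

lemma nonneg_fps_const: "c \<ge> 0 \<Longrightarrow> nonneg_fps (fps_const (of_real c))"
  by (simp add: nonneg_fps_def)

lemma nonneg_fps_deriv: "nonneg_fps F \<Longrightarrow> nonneg_fps (fps_deriv F)"
  unfolding nonneg_fps_def fps_deriv_nth by (metis nonneg_Reals_mult_I nonneg_Reals_of_nat_I)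

text \<open>
  This is the geometric series; read off from \<open>Y = 1 + H Y\<close>, each coefficient of \<open>Y\<close> is a sum of
  products of earlier ones with coefficients of \<open>H\<close>.
\<close>

lemma nonneg_fps_inverse_one_minus:
  assumes H: "nonneg_fps H" "fps_nth H 0 = 0"
  shows "nonneg_fps (inverse (1 - H))"
proof (rule nonneg_fpsI)
  define Y where "Y = inverse (1 - H)"
  have "(1 - H) * Y = 1"
    unfolding Y_def by (rule inverse_mult_eq_1') (simp add: H)
  hence Y: "Y = 1 + H * Y" by (simp add: algebra_simps)
  show "fps_nth (inverse (1 - H)) n \<in> \<real>\<^sub>\<ge>\<^sub>0" for n
    unfolding Y_def[symmetric]
  proof (induction n rule: less_induct)
    case (less n)
    have "fps_nth H i * fps_nth Y (n - i) \<in> \<real>\<^sub>\<ge>\<^sub>0" if "i \<in> {0..n}" for i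
      using less[of "n - i"] nonneg_fpsD[OF H(1), of i] H(2) that by (cases "i = 0") auto
    hence "fps_nth (1 + H * Y) n \<in> \<real>\<^sub>\<ge>\<^sub>0"
      by (auto simp: fps_mult_nth intro!: nonneg_Reals_add_I nonneg_Reals_sum)
    thus ?case using Y by simp
  qed
qed

text \<open>
  For \<open>G = \<Prod>(1 - z / \<zeta>)\<close> this is \<open>\<Sum>1 / (\<zeta> - z)\<close>: the \<open>n\<close>-th coefficient is the sum of the
  inverse \<open>(n + 1)\<close>-st powers of the zeros.  Nonnegativity of these coefficients is the only trace of the
  positivity of the zeros that is used.
\<close>

definition log_decay :: "complex fps \<Rightarrow> complex fps" where
  "log_decay G = - fps_deriv G * inverse G"

lemma log_decay_times:
  assumes "fps_nth G 0 \<noteq> 0"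
  shows "log_decay G * G = - fps_deriv G"
  using inverse_mult_eq_1[OF assms] by (simp add: log_decay_def mult.assoc)

lemma log_decay_mult:
  assumes "fps_nth F 0 \<noteq> 0" "fps_nth G 0 \<noteq> 0"
  shows "log_decay (F * G) = log_decay F + log_decay G"
proof -
  have F: "F * inverse F = 1" and G: "G * inverse G = 1"
    using assms by (auto intro: inverse_mult_eq_1')
  have "log_decay (F * G) = - (fps_deriv F * (G * inverse G) * inverse F
         + fps_deriv G * (F * inverse F) * inverse G)"
    unfolding log_decay_def fps_inverse_mult by (simp add: algebra_simps)
  thus ?thesis unfolding F G by (simp add: log_decay_def)
qed

text \<open>
  The logarithmic derivative is additive, and \<open>-(1 - H)' / (1 - H) = H' / (1 - H)\<close> is a product of
  series with nonnegative coefficients.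
\<close>

lemma log_decay_mult_one_minus:
  assumes "fps_nth F 0 = 1" "nonneg_fps (log_decay F)" "nonneg_fps H" "fps_nth H 0 = 0"
  shows "nonneg_fps (log_decay (F * (1 - H)))"
proof -
  have "log_decay (1 - H) = fps_deriv H * inverse (1 - H)"
    by (simp add: log_decay_def)
  hence "nonneg_fps (log_decay (1 - H))"
    using assms by (auto intro!: nonneg_fps_mult nonneg_fps_deriv nonneg_fps_inverse_one_minus)
  thus ?thesis using assms by (simp add: log_decay_mult nonneg_fps_add)
qed

text \<open>
  Multiplying the \<open>n\<close>-th coefficient by \<open>1 + n / \<alpha>\<close> is applying \<open>1 + \<alpha>\<^bsup>-1\<^esup> z d/dz\<close>, that is,
  multiplying \<open>F\<close> by \<open>1 - \<alpha>\<^bsup>-1\<^esup> z L\<close> with \<open>L\<close> the logarithmic decay of \<open>F\<close>.  This is the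
  formal analogue of Laguerre's theorem that such an operator preserves positivity of the zeros.
\<close>

lemma log_decay_euler_step:
  assumes F: "fps_nth F 0 = 1" "nonneg_fps (log_decay F)" and "\<alpha> > 0"
    and G: "\<And>n. fps_nth G n = of_real (1 + real n / \<alpha>) * fps_nth F n"
  shows "nonneg_fps (log_decay G)"
proof -
  define H where "H = fps_const (of_real (1 / \<alpha>)) * (fps_X * log_decay F)"
  have "F * (1 - H) = F + fps_const (of_real (1 / \<alpha>)) * (fps_X * fps_deriv F)"
  proof -
    have "F * (1 - H) = F - fps_const (of_real (1 / \<alpha>)) * (fps_X * (log_decay F * F))"
      by (simp add: H_def algebra_simps)
    also have "log_decay F * F = - fps_deriv F"
      using F(1) by (intro log_decay_times) simp
    finally show ?thesis by simp
  qed
  also have "\<dots> = G"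
  proof (rule fps_ext)
    show "fps_nth (F + fps_const (of_real (1 / \<alpha>)) * (fps_X * fps_deriv F)) n = fps_nth G n" for n
      using \<open>\<alpha> > 0\<close> by (cases n) (simp_all add: G field_simps)
  qed
  finally have "G = F * (1 - H)" ..
  moreover have "nonneg_fps H" unfolding H_def using assms
    by (intro nonneg_fps_mult nonneg_fps_X nonneg_fps_const) auto
  ultimately show ?thesis
    using F by (auto intro!: log_decay_mult_one_minus simp: H_def)
qed

text \<open>
  The Bessel series in the variable \<open>z\<^sup>2\<close>, normalized to 1 at the origin, has the coefficients
  \<open>(-1)\<^sup>n\<close> times these.
\<close>

definition j_coeff :: "real \<Rightarrow> nat \<Rightarrow> real" where
  "j_coeff \<nu> n = 1 / (4 ^ n * fact n * pochhammer (\<nu> + 1) n)"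

definition alt_fps :: "(nat \<Rightarrow> real) \<Rightarrow> complex fps" where
  "alt_fps c = Abs_fps (\<lambda>n. of_real ((-1) ^ n * c n))"

definition j_fps :: "real \<Rightarrow> complex fps" where
  "j_fps \<nu> = alt_fps (j_coeff \<nu>)"

lemma j_fps_nth_0 [simp]: "fps_nth (j_fps \<nu>) 0 = 1"
  by (simp add: j_fps_def alt_fps_def j_coeff_def)

lemma pochhammer_nu_pos: "\<nu> \<ge> 0 \<Longrightarrow> pochhammer (\<nu> + 1) n > (0::real)"
  by (rule pochhammer_pos) simp

lemma j_coeff_pos: "\<nu> \<ge> 0 \<Longrightarrow> j_coeff \<nu> n > 0"
  by (simp add: j_coeff_def pochhammer_nu_pos)

lemma j_coeff_Suc:
  assumes "\<nu> \<ge> 0"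
  shows "4 * real (Suc n) * (\<nu> + real (Suc n)) * j_coeff \<nu> (Suc n) = j_coeff \<nu> n"
  using assms pochhammer_nu_pos[OF assms, of n]
  by (simp add: j_coeff_def pochhammer_Suc divide_simps) (simp add: algebra_simps)

lemma j_coeff_shift:
  assumes "\<nu> \<ge> 0"
  shows "(\<nu> + 1) * j_coeff \<nu> n = (\<nu> + 1 + real n) * j_coeff (\<nu> + 1) n"
proof -
  have "pochhammer (\<nu> + 1) n * (\<nu> + 1 + real n) = (\<nu> + 1) * pochhammer (\<nu> + 2) n"
    using pochhammer_Suc[of "\<nu> + 1" n] pochhammer_rec[of "\<nu> + 1" n] by (simp add: add_ac)
  moreover have "pochhammer (\<nu> + 1) n > 0" "pochhammer (\<nu> + 2) n > 0"
    using assms by (auto intro!: pochhammer_pos)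
  ultimately show ?thesis using assms
    by (simp add: j_coeff_def divide_simps add_ac) (simp add: algebra_simps)
qed

lemma Suc_times_j_coeff:
  assumes "\<nu> \<ge> 0"
  shows "real (Suc n) * j_coeff \<nu> (Suc n) = 1 / (4 * (\<nu> + 1)) * j_coeff (\<nu> + 1) n"
proof -
  have "(\<nu> + real (Suc n)) * (4 * (\<nu> + 1) * (real (Suc n) * j_coeff \<nu> (Suc n))) = (\<nu> + 1) * j_coeff \<nu> n"
    using j_coeff_Suc[OF assms, of n] by (simp only: flip: j_coeff_Suc[OF assms, of n]) (simp only: mult_ac)
  also have "\<dots> = (\<nu> + real (Suc n)) * j_coeff (\<nu> + 1) n"
    using j_coeff_shift[OF assms, of n] by (simp add: add_ac)
  finally have "4 * (\<nu> + 1) * (real (Suc n) * j_coeff \<nu> (Suc n)) = j_coeff (\<nu> + 1) n"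
    using assms by (subst (asm) mult_left_cancel) auto
  thus ?thesis using assms by (simp add: field_simps)
qed

lemma fps_deriv_j_fps:
  assumes "\<nu> \<ge> 0"
  shows "fps_deriv (j_fps \<nu>) = - (fps_const (of_real (1 / (4 * (\<nu> + 1)))) * j_fps (\<nu> + 1))"
proof (rule fps_ext)
  fix n
  show "fps_nth (fps_deriv (j_fps \<nu>)) n
      = fps_nth (- (fps_const (of_real (1 / (4 * (\<nu> + 1)))) * j_fps (\<nu> + 1))) n"
    using arg_cong[OF Suc_times_j_coeff[OF assms, of n], of "\<lambda>x. complex_of_real ((-1) ^ n * x)"]
    by (simp add: j_fps_def alt_fps_def mult_ac)
qed

text \<open>
  This is the three-term recurrence
  \<open>J\<^bsub>\<nu>\<^esub>(z) + J\<^bsub>\<nu>+2\<^esub>(z) = (2 (\<nu> + 1) / z) J\<^bsub>\<nu>+1\<^esub>(z)\<close>.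
\<close>

lemma j_fps_recurrence:
  assumes "\<nu> \<ge> 0"
  shows "j_fps \<nu> = j_fps (\<nu> + 1)
           - fps_const (of_real (1 / (4 * (\<nu> + 1) * (\<nu> + 2)))) * (fps_X * j_fps (\<nu> + 2))"
proof (rule fps_ext)
  fix n
  show "fps_nth (j_fps \<nu>) n = fps_nth (j_fps (\<nu> + 1)
           - fps_const (of_real (1 / (4 * (\<nu> + 1) * (\<nu> + 2)))) * (fps_X * j_fps (\<nu> + 2))) n"
  proof (cases n)
    case (Suc m)
    have 1: "real (Suc m) * j_coeff (\<nu> + 1) (Suc m) = 1 / (4 * (\<nu> + 2)) * j_coeff (\<nu> + 2) m"
      using Suc_times_j_coeff[of "\<nu> + 1" m] assms by (simp add: add_ac)
    have "(\<nu> + 1) * j_coeff \<nu> (Suc m) = (\<nu> + 1) * j_coeff (\<nu> + 1) (Suc m) + real (Suc m) * j_coeff (\<nu> + 1) (Suc m)"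
      using j_coeff_shift[OF assms, of "Suc m"] by (simp add: algebra_simps)
    hence "j_coeff \<nu> (Suc m) = j_coeff (\<nu> + 1) (Suc m) + 1 / (4 * (\<nu> + 1) * (\<nu> + 2)) * j_coeff (\<nu> + 2) m"
      unfolding 1 using assms by (simp add: divide_simps) (simp add: algebra_simps)
    from arg_cong[OF this, of "\<lambda>x. complex_of_real ((-1) ^ m * x)"] show ?thesis
      by (simp add: Suc j_fps_def alt_fps_def algebra_simps)
  qed simp
qed

text \<open>
  Divided by the series of order \<open>\<nu>\<close>, the recurrence becomes \<open>p\<^bsub>\<nu>\<^esub> = 1 + c z p\<^bsub>\<nu>+1\<^esub> p\<^bsub>\<nu>\<^esub>\<close>
  with \<open>c > 0\<close> for the quotient \<open>p\<^bsub>\<nu>\<^esub>\<close>.  It expresses the \<open>n\<close>-th coefficient for one order by lower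
  coefficients for two orders, so the induction on \<open>n\<close> has to treat all orders at once.
\<close>

lemma j_fps_quotient_nonneg:
  assumes "\<nu> \<ge> 0"
  shows "nonneg_fps (j_fps (\<nu> + 1) * inverse (j_fps \<nu>))"
proof (rule nonneg_fpsI)
  define p where "p = (\<lambda>\<nu>. j_fps (\<nu> + 1) * inverse (j_fps \<nu>))"
  have rec: "p \<nu> = 1 + fps_const (of_real (1 / (4 * (\<nu> + 1) * (\<nu> + 2)))) * (fps_X * (p (\<nu> + 1) * p \<nu>))"
    if "\<nu> \<ge> 0" for \<nu>
  proof -
    have i: "j_fps \<nu> * inverse (j_fps \<nu>) = 1" for \<nu> by (rule inverse_mult_eq_1') simp
    have "p (\<nu> + 1) * p \<nu> = (j_fps (\<nu> + 1) * inverse (j_fps (\<nu> + 1))) * j_fps (\<nu> + 2) * inverse (j_fps \<nu>)"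
      unfolding p_def by (simp add: mult_ac add.assoc)
    also have "\<dots> = j_fps (\<nu> + 2) * inverse (j_fps \<nu>)" unfolding i by simp
    finally have pp: "p (\<nu> + 1) * p \<nu> = j_fps (\<nu> + 2) * inverse (j_fps \<nu>)" .
    have "1 = j_fps \<nu> * inverse (j_fps \<nu>)" using i by simp
    also have "\<dots> = (j_fps (\<nu> + 1)
           - fps_const (of_real (1 / (4 * (\<nu> + 1) * (\<nu> + 2)))) * (fps_X * j_fps (\<nu> + 2))) * inverse (j_fps \<nu>)"
      using j_fps_recurrence[OF that] by simp
    also have "\<dots> = p \<nu> - fps_const (of_real (1 / (4 * (\<nu> + 1) * (\<nu> + 2)))) * (fps_X * (p (\<nu> + 1) * p \<nu>))"
      unfolding pp by (simp add: p_def algebra_simps)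
    finally show ?thesis by (simp add: algebra_simps)
  qed
  have "\<forall>\<nu>\<ge>0. fps_nth (p \<nu>) n \<in> \<real>\<^sub>\<ge>\<^sub>0" for n
  proof (induction n rule: less_induct)
    case (less n)
    show ?case
    proof (intro allI impI)
      fix \<nu> :: real assume \<nu>: "\<nu> \<ge> 0"
      show "fps_nth (p \<nu>) n \<in> \<real>\<^sub>\<ge>\<^sub>0"
      proof (cases n)
        case 0
        thus ?thesis by (simp add: p_def)
      next
        case (Suc m)
        have "fps_nth (p (\<nu> + 1) * p \<nu>) m \<in> \<real>\<^sub>\<ge>\<^sub>0"
          unfolding fps_mult_nth using less \<nu> Suc
          by (intro nonneg_Reals_sum nonneg_Reals_mult_I) auto
        moreover have "complex_of_real (1 / (4 * (\<nu> + 1) * (\<nu> + 2))) \<in> \<real>\<^sub>\<ge>\<^sub>0"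
          using \<nu> by (subst nonneg_Reals_of_real_iff) auto
        ultimately have "fps_nth (1 + fps_const (of_real (1 / (4 * (\<nu> + 1) * (\<nu> + 2))))
                           * (fps_X * (p (\<nu> + 1) * p \<nu>))) n \<in> \<real>\<^sub>\<ge>\<^sub>0"
          using nonneg_Reals_mult_I by (simp add: Suc del: of_real_divide)
        thus ?thesis by (simp only: rec[OF \<nu>, symmetric])
      qed
    qed
  qed
  thus "fps_nth (j_fps (\<nu> + 1) * inverse (j_fps \<nu>)) n \<in> \<real>\<^sub>\<ge>\<^sub>0" for n
    using assms by (simp add: p_def)
qed

text \<open>
  The derivative of a Bessel series is a negative multiple of the next one, so that its logarithmic decay is
  a positive multiple of the quotient of the two.
\<close>

lemma log_decay_j_fps:
  assumes "\<nu> \<ge> 0"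
  shows "nonneg_fps (log_decay (j_fps \<nu>))"
proof -
  have "log_decay (j_fps \<nu>) = fps_const (of_real (1 / (4 * (\<nu> + 1)))) * (j_fps (\<nu> + 1) * inverse (j_fps \<nu>))"
    unfolding log_decay_def fps_deriv_j_fps[OF assms] by (simp only: mult.assoc minus_minus)
  thus ?thesis using assms j_fps_quotient_nonneg[OF assms]
    by (metis (no_types, opaque_lifting) divide_nonneg_pos mult_pos_pos add_nonneg_pos zero_less_numeral zero_less_one zero_le_one nonneg_fps_const nonneg_fps_mult)
qed

section \<open>Functions with nonnegative logarithmic decay in the unit disk\<close>

text \<open>
  The derivative of \<open>1/G\<close> is \<open>L / G\<close>, where \<open>L\<close> is the logarithmic decay.
\<close>

lemma nonneg_fps_inverse_of_log_decay:
  assumes G: "fps_nth G 0 = 1" and L: "nonneg_fps (log_decay G)"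
  shows "nonneg_fps (inverse G)"
proof (rule nonneg_fpsI)
  have "fps_deriv (inverse G) = inverse G * log_decay G"
    unfolding log_decay_def using fps_inverse_deriv[of G] G
    by (simp add: power2_eq_square mult_ac)
  hence d: "of_nat (Suc n) * fps_nth (inverse G) (Suc n)
            = (\<Sum>i=0..n. fps_nth (inverse G) i * fps_nth (log_decay G) (n - i))" for n
    by (metis fps_mult_nth fps_deriv_nth Suc_eq_plus1)
  show "fps_nth (inverse G) n \<in> \<real>\<^sub>\<ge>\<^sub>0" for n
  proof (induction n rule: less_induct)
    case (less n)
    show ?case
    proof (cases n)
      case 0
      thus ?thesis using G by simp
    next
      case (Suc m)
      have "of_nat (Suc m) * fps_nth (inverse G) (Suc m) \<in> \<real>\<^sub>\<ge>\<^sub>0"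
        unfolding d using less Suc nonneg_fpsD[OF L]
        by (intro nonneg_Reals_sum nonneg_Reals_mult_I) auto
      hence "of_nat (Suc m) * fps_nth (inverse G) (Suc m) / of_nat (Suc m) \<in> (\<real>\<^sub>\<ge>\<^sub>0 :: complex set)"
        using nonneg_Reals_divide_I nonneg_Reals_of_nat_I by blast
      moreover have "of_nat (Suc m) * fps_nth (inverse G) (Suc m) / of_nat (Suc m) = fps_nth (inverse G) (Suc m)"
        by (simp del: of_nat_Suc)
      ultimately show ?thesis using Suc by simp
    qed
  qed
qed

lemma norm_eval_nonneg_fps_le:
  assumes F: "nonneg_fps F" and z: "norm z \<le> r" "ereal r < fps_conv_radius F"
  shows "norm (eval_fps F z) \<le> Re (eval_fps F (of_real r))"
proof -
  have r: "r \<ge> 0" using z(1) norm_ge_zero[of z] by linarith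
  have c: "fps_nth F n = of_real (norm (fps_nth F n))" for n
    using nonneg_fpsD[OF F, of n] by (auto elim!: nonneg_Reals_cases)
  have "(\<lambda>n. fps_nth F n * of_real r ^ n) sums eval_fps F (of_real r)"
    using z r by (intro sums_eval_fps) simp
  hence "(\<lambda>n. Re (fps_nth F n * of_real r ^ n)) sums Re (eval_fps F (of_real r))"
    by (rule sums_Re)
  also have "(\<lambda>n. Re (fps_nth F n * of_real r ^ n)) = (\<lambda>n. norm (fps_nth F n) * r ^ n)"
    by (subst c) (simp flip: of_real_power of_real_mult)
  finally have s: "(\<lambda>n. norm (fps_nth F n) * r ^ n) sums Re (eval_fps F (of_real r))" .
  have "norm (eval_fps F z) \<le> (\<Sum>n. norm (fps_nth F n) * r ^ n)"
    unfolding eval_fps_def using sums_summable[OF s] z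
    by (intro norm_suminf_le) (auto simp: norm_mult norm_power intro!: mult_left_mono power_mono)
  thus ?thesis using sums_unique[OF s] by simp
qed

text \<open>
  Let \<open>z\<close> be a zero of least modulus \<open>r\<close>.  Inside that modulus \<open>1/G\<close> is bounded in absolute value by its
  own values on the positive real axis, as its coefficients are nonnegative; that is, \<open>G\<close> is smallest in absolute
  value there.  Letting the modulus tend to \<open>r\<close> shows that \<open>r\<close> is a zero as well.
\<close>

lemma no_zero_in_disk:
  assumes G: "fps_conv_radius G = \<infinity>" "nonneg_fps (inverse G)"
    and pos: "\<And>r. 0 \<le> r \<Longrightarrow> r < 1 \<Longrightarrow> eval_fps G (of_real r) \<noteq> 0"
    and z: "z \<in> ball 0 1"
  shows "eval_fps G z \<noteq> 0"
proof
  assume z0: "eval_fps G z = 0"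
  have cont: "continuous_on A (eval_fps G)" for A
    using continuous_on_eval_fps'[of A "\<lambda>z. z" G] G by simp
  define Z where "Z = {w \<in> cball 0 (norm z). eval_fps G w = 0}"
  have "closed Z" unfolding Z_def
    by (rule continuous_closed_preimage_constant[OF cont closed_cball])
  hence "compact Z"
    using compact_Int_closed[OF compact_cball, of Z 0 "norm z"] by (simp add: Z_def Int_def)
  moreover have "Z \<noteq> {}" using z0 by (auto simp: Z_def)
  ultimately obtain z1 where z1: "z1 \<in> Z" and min: "\<And>w. w \<in> Z \<Longrightarrow> norm z1 \<le> norm w"
    using continuous_attains_inf[of Z norm] by (metis continuous_on_norm_id)
  define r where "r = norm z1"
  have r: "r \<le> norm z" "eval_fps G z1 = 0" using z1 by (auto simp: Z_def r_def)
  have r1: "0 \<le> r" "r < 1" using z r by (auto simp: r_def)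
  \<comment> \<open>As \<open>z1\<close> is a zero of least modulus, \<open>1/G\<close> is analytic in the disk of radius \<open>r\<close>.\<close>
  have nz: "eval_fps G w \<noteq> 0" if "norm w < r" for w
    using min[of w] that r by (auto simp: Z_def r_def)
  have rad: "fps_conv_radius (inverse G) \<ge> ereal r"
    using fps_conv_radius_inverse[of "ereal r" G] nz G by simp
  have le: "norm (eval_fps G (of_real (t * r))) \<le> norm (eval_fps G (of_real t * z1))"
    if t: "0 < t" "t < 1" for t
  proof (cases "r = 0")
    case True
    thus ?thesis by (simp add: r_def)
  next
    case False
    hence tr: "t * r < r" "0 \<le> t * r" using t r1 by auto
    have n: "norm (of_real t * z1) = t * r" "norm (complex_of_real (t * r)) = t * r"
      using t tr by (simp_all add: norm_mult r_def)
    have e: "eval_fps (inverse G) w = inverse (eval_fps G w)" if "norm w < r" for w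
      by (rule eval_fps_inverse[where r = "ereal r"]) (use nz G that in auto)
    have "norm (eval_fps (inverse G) (of_real t * z1)) \<le> Re (eval_fps (inverse G) (of_real (t * r)))"
      using rad tr n by (intro norm_eval_nonneg_fps_le[OF G(2)]) (auto intro: less_le_trans[of _ "ereal r"])
    also have "\<dots> \<le> norm (eval_fps (inverse G) (of_real (t * r)))"
      by (rule complex_Re_le_cmod)
    finally have "inverse (norm (eval_fps G (of_real t * z1))) \<le> inverse (norm (eval_fps G (of_real (t * r))))"
      using e n tr by (simp add: norm_inverse)
    thus ?thesis
      using nz[of "of_real t * z1"] nz[of "of_real (t * r)"] n tr
      by (subst (asm) inverse_le_iff_le) auto
  qed
  have lim: "((\<lambda>t::real. norm (eval_fps G (of_real t * w))) \<longlongrightarrow> norm (eval_fps G w)) (at_left 1)" for w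
  proof -
    have "continuous_on UNIV (\<lambda>t::real. norm (eval_fps G (of_real t * w)))"
      using G by (intro continuous_intros) auto
    hence "isCont (\<lambda>t::real. norm (eval_fps G (of_real t * w))) 1"
      by (simp add: continuous_on_eq_continuous_at)
    hence "((\<lambda>t::real. norm (eval_fps G (of_real t * w))) \<longlongrightarrow> norm (eval_fps G (of_real 1 * w))) (at 1)"
      by (simp add: isCont_def)
    thus ?thesis by (simp add: filterlim_at_split)
  qed
  have "norm (eval_fps G (of_real r)) \<le> norm (eval_fps G z1)"
  proof (rule tendsto_le[OF _ lim lim])
    have "eventually (\<lambda>t::real. t \<in> {0<..<1}) (at_left 1)"
      by (intro eventually_at_leftI[of 0]) auto
    thus "\<forall>\<^sub>F t in at_left 1. norm (eval_fps G (of_real t * of_real r)) \<le> norm (eval_fps G (of_real t * z1))"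
      by eventually_elim (use le in auto)
  qed auto
  thus False using pos[of r] r r1 by simp
qed

text \<open>
  As \<open>G\<close> has no zeros in the disk, the series of its logarithmic decay \<open>L\<close> converges there.
  Its coefficients are nonnegative, so \<open>\<bar>L(z)\<bar> \<le> L(t)\<close> for \<open>\<bar>z\<bar> < t < 1\<close>, and \<open>L(t)\<close> tends to
  \<open>-G'(1)/G(1)\<close> as \<open>t\<close> tends to 1.
\<close>

lemma log_decay_bound_in_disk:
  assumes G: "fps_conv_radius G = \<infinity>" "fps_nth G 0 = 1" "nonneg_fps (log_decay G)"
    and pos: "\<And>r. 0 \<le> r \<Longrightarrow> r \<le> 1 \<Longrightarrow> eval_fps G (of_real r) \<noteq> 0"
    and one: "Re (- eval_fps (fps_deriv G) 1 / eval_fps G 1) \<le> 1"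
    and z: "z \<in> ball 0 1"
  shows "eval_fps G z \<noteq> 0" "norm (eval_fps (fps_deriv G) z / eval_fps G z) \<le> 1"
proof -
  have nz: "eval_fps G w \<noteq> 0" if "w \<in> ball 0 1" for w
    using no_zero_in_disk[OF G(1) nonneg_fps_inverse_of_log_decay[OF G(2,3)] pos that] by simp
  thus "eval_fps G z \<noteq> 0" using z by simp
  have radi: "fps_conv_radius (inverse G) \<ge> 1"
    using fps_conv_radius_inverse[of 1 G] nz G by (simp add: one_ereal_def)
  have radd: "fps_conv_radius (fps_deriv G) = \<infinity>"
    using fps_conv_radius_deriv[of G] G by simp
  have "fps_conv_radius (log_decay G) \<ge> min (fps_conv_radius (- fps_deriv G)) (fps_conv_radius (inverse G))"
    unfolding log_decay_def by (rule fps_conv_radius_mult)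
  hence rad: "fps_conv_radius (log_decay G) \<ge> 1"
    using radi radd by (simp add: min_def split: if_splits)
  have ev: "eval_fps (log_decay G) w = - eval_fps (fps_deriv G) w / eval_fps G w" if "norm w < 1" for w
  proof -
    have lt: "ereal (norm w) < fps_conv_radius (inverse G)" "ereal (norm w) < fps_conv_radius (- fps_deriv G)"
      using that radi radd by (auto intro: less_le_trans[of _ 1] simp: one_ereal_def)
    have "eval_fps (log_decay G) w = eval_fps (- fps_deriv G) w * eval_fps (inverse G) w"
      unfolding log_decay_def by (rule eval_fps_mult[OF lt(2,1)])
    also have "eval_fps (- fps_deriv G) w = - eval_fps (fps_deriv G) w"
      using radd by (intro eval_fps_minus) simp
    also have "eval_fps (inverse G) w = inverse (eval_fps G w)"
      by (rule eval_fps_inverse[where r = 1]) (use nz G that in \<open>auto simp: one_ereal_def\<close>)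
    finally show ?thesis by (simp add: field_simps)
  qed
  have le: "norm (eval_fps (log_decay G) z) \<le> Re (- eval_fps (fps_deriv G) (of_real t) / eval_fps G (of_real t))"
    if "norm z < t" "t < 1" for t
  proof -
    have "0 \<le> t" using that norm_ge_zero[of z] by linarith
    hence t: "norm (complex_of_real t) < 1" using that by simp
    have "norm (eval_fps (log_decay G) z) \<le> Re (eval_fps (log_decay G) (of_real t))"
      using that rad by (intro norm_eval_nonneg_fps_le[OF G(3)]) (auto intro: less_le_trans[of _ 1] simp: one_ereal_def)
    thus ?thesis unfolding ev[OF t] .
  qed
  have lim: "((\<lambda>t. Re (- eval_fps (fps_deriv G) (of_real t) / eval_fps G (of_real t)))
           \<longlongrightarrow> Re (- eval_fps (fps_deriv G) (of_real 1) / eval_fps G (of_real 1))) (at_left (1::real))"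
    using G radd pos[of 1] by (intro tendsto_intros continuous_within_tendsto_compose'[OF continuous_eval_fps]) auto
  have "norm (eval_fps (log_decay G) z) \<le> Re (- eval_fps (fps_deriv G) (of_real 1) / eval_fps G (of_real 1))"
  proof (rule tendsto_lowerbound[OF lim])
    have "eventually (\<lambda>t::real. t \<in> {norm z<..<1}) (at_left 1)"
      using z by (intro eventually_at_leftI[of "norm z"]) auto
    thus "\<forall>\<^sub>F t in at_left 1. norm (eval_fps (log_decay G) z)
            \<le> Re (- eval_fps (fps_deriv G) (of_real t) / eval_fps G (of_real t))"
      by eventually_elim (use le in auto)
  qed auto
  also have "\<dots> \<le> 1" using one by simp
  finally show "norm (eval_fps (fps_deriv G) z / eval_fps G z) \<le> 1"
    using ev[of z] z by (simp add: norm_divide)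
qed

section \<open>Criteria for starlike and close-to-convex functions\<close>

text \<open>
  The theorem of Noshiro and Warschawski: the difference quotient is the mean of \<open>F'\<close> over a
  segment.
\<close>

lemma Re_difference_quotient_pos:
  fixes F F' :: "complex \<Rightarrow> complex"
  assumes S: "convex S"
    and F: "\<And>z. z \<in> S \<Longrightarrow> (F has_field_derivative F' z) (at z)"
    and pos: "\<And>z. z \<in> S \<Longrightarrow> Re (F' z) > 0"
    and xy: "x \<in> S" "y \<in> S" "x \<noteq> y"
  shows "Re ((F y - F x) / (y - x)) > 0"
proof -
  define h where "h = (\<lambda>t::real. Re (F (x + of_real t * (y - x)) / (y - x)))"
  have in_S: "x + of_real t * (y - x) \<in> S" if "0 \<le> t" "t \<le> 1" for t
  proof -
    have "(1 - t) *\<^sub>R x + t *\<^sub>R y \<in> S"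
      using that xy by (intro convexD_alt[OF S]) auto
    thus ?thesis by (simp add: scaleR_conv_of_real algebra_simps)
  qed
  have d: "(h has_real_derivative Re (F' (x + of_real t * (y - x)))) (at t)" if "0 \<le> t" "t \<le> 1" for t
  proof -
    have "((\<lambda>w. x + w * (y - x)) has_field_derivative y - x) (at (of_real t))"
      by (auto intro!: derivative_eq_intros)
    from DERIV_cdivide[OF DERIV_chain2[OF F[OF in_S[OF that]] this], of "y - x"]
    have "((\<lambda>w. F (x + w * (y - x)) / (y - x)) has_field_derivative F' (x + of_real t * (y - x)))
            (at (of_real t))"
      using xy by simp
    hence "((\<lambda>t. F (x + of_real t * (y - x)) / (y - x)) has_vector_derivative F' (x + of_real t * (y - x))) (at t)"
      by (rule has_vector_derivative_real_field)
    hence "((\<lambda>t. Re (F (x + of_real t * (y - x)) / (y - x))) has_vector_derivative Re (F' (x + of_real t * (y - x)))) (at t)"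
      by (rule bounded_linear.has_vector_derivative[OF bounded_linear_Re])
    thus ?thesis by (simp add: h_def has_real_derivative_iff_has_vector_derivative)
  qed
  have "h 0 < h 1"
  proof (rule DERIV_pos_imp_increasing[of 0 1 h])
    fix t :: real assume "0 \<le> t" "t \<le> 1"
    thus "\<exists>D. (h has_real_derivative D) (at t) \<and> D > 0"
      using d[of t] pos[OF in_S[of t]] by blast
  qed simp
  thus ?thesis by (simp add: h_def diff_divide_distrib)
qed

text \<open>
  In the coordinate \<open>log z\<close> a function on the disk with \<open>Re (z f'/f) > 0\<close> becomes a function \<open>F\<close> on the left half
  plane whose derivative has positive real part.  Up to a period, \<open>F(x)\<close> arises from
  \<open>F(y)\<close> by the shift \<open>ln t\<close> to the left, and the positive difference quotient forces \<open>x\<close> to lie to the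
  left of \<open>y\<close>.  The case \<open>t = 1\<close> is injectivity.
\<close>

lemma exp_comparison_left_half_plane:
  fixes F F' :: "complex \<Rightarrow> complex"
  assumes F: "\<And>z. Re z < 0 \<Longrightarrow> (F has_field_derivative F' z) (at z)"
    and pos: "\<And>z. Re z < 0 \<Longrightarrow> Re (F' z) > 0"
    and per: "\<And>z n. F (z + of_int n * (2 * pi * \<i>)) = F z + of_int n * (2 * pi * \<i>)"
    and xy: "Re x < 0" "Re y < 0" and t: "0 < t" "t \<le> 1"
    and eq: "exp (F x) = of_real t * exp (F y)"
  shows "exp x = exp y \<or> (t < 1 \<and> Re x < Re y)"
proof -
  have "exp (of_real (ln t)) = complex_of_real t"
    using t by (metis exp_ln exp_of_real)
  hence "exp (F x) = exp (of_real (ln t) + F y)"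
    using eq by (simp add: exp_add del: of_real_exp)
  then obtain n :: int where "F x = of_real (ln t) + F y + of_int n * (2 * pi * \<i>)"
    by (auto simp: exp_eq mult_ac)
  define y' where "y' = y + of_int n * (2 * pi * \<i>)"
  have Fx: "F x - F y' = of_real (ln t)"
    using \<open>F x = _\<close> per[of y n] by (simp add: y'_def)
  have ey: "exp y' = exp y" "Re y' = Re y"
    by (auto simp: y'_def exp_eq mult_ac)
  show ?thesis
  proof (cases "x = y'")
    case False
    have "Re ((F x - F y') / (x - y')) > 0"
      by (rule Re_difference_quotient_pos[of "{z. Re z < 0}" F F'])
         (use F pos xy ey False convex_halfspace_Re_lt[of 0] in auto)
    hence "ln t * Re (x - y') > 0"
      unfolding Fx by (auto simp: Re_divide zero_less_divide_iff dest: order.strict_trans1[OF sum_power2_ge_zero])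
    moreover have "ln t \<le> 0" using t by simp
    ultimately have "ln t < 0 \<and> Re (x - y') < 0"
      by (auto simp: zero_less_mult_iff)
    thus ?thesis using t ey by simp
  qed (use ey in auto)
qed

text \<open>
  Injectivity is the case \<open>t = 1\<close> of the comparison in logarithmic coordinates.  For a point
  \<open>z0 \<noteq> 0\<close> of the disk, consider the set of all \<open>t\<close> in \<open>(0,1]\<close> for which \<open>t f(z0)\<close> is
  a value of \<open>f\<close>.  It is open because \<open>f\<close> is an open map, and it is closed because the
  comparison places the preimages in the compact disk of radius \<open>\<bar>z0\<bar>\<close>; so it is everything.
\<close>

lemma starlike_in_disk_if_Re_pos:
  assumes g: "g holomorphic_on ball 0 1"
    and nz: "\<And>z. z \<in> ball 0 1 \<Longrightarrow> g z \<noteq> 0"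
    and pos: "\<And>z. z \<in> ball 0 1 \<Longrightarrow> Re (1 + z * deriv g z / g z) > 0"
  shows "starlike_in_disk (\<lambda>z. z * g z)"
proof -
  define f where "f = (\<lambda>z. z * g z)"
  have holf: "f holomorphic_on ball 0 1" unfolding f_def by (intro holomorphic_intros g)
  obtain l where l: "l holomorphic_on ball 0 1" "\<And>z. z \<in> ball 0 1 \<Longrightarrow> exp (l z) = g z"
    using holomorphic_logarithm_exists[of "ball 0 1" g 0] g nz by auto
  \<comment> \<open>This is \<open>f\<close> in logarithmic coordinates: \<open>exp (F z) = f (exp z)\<close>.\<close>
  define F where "F = (\<lambda>z. z + l (exp z))"
  have inb: "exp z \<in> ball 0 1" if "Re z < 0" for z :: complex using that by simp
  have dF: "(F has_field_derivative 1 + deriv l (exp z) * exp z) (at z)" if "Re z < 0" for z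
  proof -
    have "(l has_field_derivative deriv l (exp z)) (at (exp z))"
      using holomorphic_derivI[OF l(1) open_ball inb[OF that]] .
    from DERIV_chain'[OF DERIV_exp this] show ?thesis
      unfolding F_def by (auto intro!: derivative_eq_intros)
  qed
  have dl: "deriv l z = deriv g z / g z" if z: "z \<in> ball 0 1" for z
  proof -
    have "(l has_field_derivative deriv l z) (at z)"
      using holomorphic_derivI[OF l(1) open_ball z] .
    hence "((\<lambda>z. exp (l z)) has_field_derivative exp (l z) * deriv l z) (at z)"
      by (auto intro!: derivative_eq_intros)
    hence "(g has_field_derivative exp (l z) * deriv l z) (at z)"
      by (rule has_field_derivative_transform_within_open[OF _ open_ball z]) (use l in auto)
    hence "deriv g z = g z * deriv l z" using l z by (simp add: DERIV_imp_deriv)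
    thus ?thesis using nz[OF z] by simp
  qed
  have pF: "Re (1 + deriv l (exp z) * exp z) > 0" if "Re z < 0" for z
    using pos[OF inb[OF that]] dl[OF inb[OF that]] by (simp add: mult_ac)
  have per: "F (z + of_int n * (2 * pi * \<i>)) = F z + of_int n * (2 * pi * \<i>)" for z n
  proof -
    have "exp (z + of_int n * (2 * pi * \<i>)) = exp z" by (auto simp: exp_eq mult_ac)
    thus ?thesis by (simp add: F_def)
  qed
  have eF: "exp (F z) = f (exp z)" if "Re z < 0" for z
    using l(2)[OF inb[OF that]] by (simp add: F_def f_def exp_add)
  have cmp: "z1 = z2 \<or> (t < 1 \<and> norm z1 < norm z2)"
    if z: "z1 \<in> ball 0 1" "z2 \<in> ball 0 1" "z1 \<noteq> 0" "z2 \<noteq> 0" and t: "0 < t" "t \<le> 1"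
      and eq: "f z1 = of_real t * f z2" for z1 z2 t
  proof -
    have r: "Re (Ln z1) < 0" "Re (Ln z2) < 0" using z by auto
    have "exp (F (Ln z1)) = of_real t * exp (F (Ln z2))"
      using eF[OF r(1)] eF[OF r(2)] eq z by simp
    from exp_comparison_left_half_plane[OF dF pF per r t this] show ?thesis
      using z by auto
  qed
  have f0: "f z = 0 \<longleftrightarrow> z = 0" if "z \<in> ball 0 1" for z using nz[OF that] by (simp add: f_def)
  have inj: "inj_on f (ball 0 1)"
  proof (rule inj_onI)
    fix x y assume xy: "x \<in> ball 0 1" "y \<in> ball 0 1" "f x = f y"
    show "x = y"
    proof (cases "x = 0 \<or> y = 0")
      case True
      thus ?thesis using f0 xy by metis
    next
      case False
      thus ?thesis using cmp[of x y 1] xy by auto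
    qed
  qed
  have star: "of_real t * f z0 \<in> f ` ball 0 1" if z0: "z0 \<in> ball 0 1" "z0 \<noteq> 0" and t: "0 < t" "t \<le> 1" for z0 t
  proof -
    let ?S = "{0<..1::real}" and ?h = "\<lambda>t::real. of_real t * f z0"
    define T where "T = ?S \<inter> ?h -` (f ` ball 0 1)"
    have T': "T = ?S \<inter> ?h -` (f ` cball 0 (norm z0))"
    proof
      show "?S \<inter> ?h -` (f ` cball 0 (norm z0)) \<subseteq> T" using z0 by (auto simp: T_def)
      show "T \<subseteq> ?S \<inter> ?h -` (f ` cball 0 (norm z0))"
      proof
        fix s assume s: "s \<in> T"
        then obtain z where z: "z \<in> ball 0 1" "f z = of_real s * f z0" by (auto simp: T_def)
        have "z \<noteq> 0" using z s f0[OF z(1)] f0[OF z0(1)] z0 by (auto simp: T_def)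
        hence "norm z \<le> norm z0" using cmp[of z z0 s] z z0 s by (auto simp: T_def)
        hence "?h s \<in> f ` cball 0 (norm z0)" using z(2) by (intro image_eqI[of _ _ z]) auto
        thus "s \<in> ?S \<inter> ?h -` (f ` cball 0 (norm z0))" using s by (simp add: T_def)
      qed
    qed
    have ch: "continuous_on ?S ?h" by (intro continuous_intros)
    have "openin (top_of_set ?S) T" unfolding T_def
      by (rule continuous_openin_preimage_gen[OF ch]) (rule open_mapping_thm3[OF holf open_ball inj])
    moreover have "closedin (top_of_set ?S) T" unfolding T'
    proof (rule continuous_closedin_preimage[OF ch])
      have "cball 0 (norm z0) \<subseteq> (ball 0 1 :: complex set)" using z0 by auto
      hence "compact (f ` cball 0 (norm z0))"
        using holf by (intro compact_continuous_image compact_cball)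
          (meson holomorphic_on_imp_continuous_on continuous_on_subset)
      thus "closed (f ` cball 0 (norm z0))" by (rule compact_imp_closed)
    qed
    moreover have "connected ?S" by simp
    moreover have "1 \<in> T" using z0 by (simp add: T_def)
    ultimately have "T = ?S" unfolding connected_clopen by blast
    thus ?thesis using t by (auto simp: T_def)
  qed
  have "closed_segment 0 w \<subseteq> f ` ball 0 1" if w: "w \<in> f ` ball 0 1" for w
  proof
    fix v assume "v \<in> closed_segment 0 w"
    then obtain t where t: "0 \<le> t" "t \<le> 1" "v = of_real t * w"
      by (auto simp: in_segment scaleR_conv_of_real)
    obtain z0 where z0: "z0 \<in> ball 0 1" "w = f z0" using w by blast
    show "v \<in> f ` ball 0 1"
    proof (cases "t = 0 \<or> z0 = 0")
      case True
      hence "v = f 0" using t z0 by (auto simp: f_def)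
      thus ?thesis by (intro image_eqI[of _ _ 0]) auto
    next
      case False
      thus ?thesis using star[of z0 t] z0 t by simp
    qed
  qed
  thus ?thesis using holf inj unfolding starlike_in_disk_def f_def by simp
qed

text \<open>
  The series of the derivative \<open>D\<close> of \<open>h\<close> is dominated, apart from its constant term, by
  \<open>3 \<bar>D(0)\<bar>\<close> times the geometric series in \<open>\<bar>z\<bar>/4\<close> without its constant term, whose sum is less than 1/3.
  So \<open>D(z) / D(0)\<close> has positive real part, and \<open>\<phi>(z) = D(0) z\<close> is a convex comparison
  function.
\<close>

lemma close_to_convex_if_derivative_dominated:
  fixes h :: "complex \<Rightarrow> complex" and D :: "complex fps"
  assumes D: "fps_conv_radius D = \<infinity>" "fps_nth D 0 \<noteq> 0"
    and D1: "norm (fps_nth D 1) \<le> 3 / 4 * norm (fps_nth D 0)"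
    and DS: "\<And>m. m \<ge> 1 \<Longrightarrow> norm (fps_nth D (Suc m)) \<le> 1 / 4 * norm (fps_nth D m)"
    and h: "\<And>z. (h has_field_derivative eval_fps D z) (at z)"
  shows "close_to_convex_in_disk h" "inj_on h (ball 0 1)"
proof -
  let ?d = "fps_nth D 0"
  have bnd: "norm (fps_nth D (Suc m)) \<le> 3 * norm ?d * (1 / 4) ^ Suc m" for m
  proof (induction m)
    case (Suc m)
    thus ?case using DS[of "Suc m"] by simp
  qed (use D1 in simp)
  have pos: "Re (eval_fps D z / ?d) > 0" if z: "z \<in> ball 0 1" for z
  proof -
    let ?r = "norm z / 4"
    have r: "0 \<le> ?r" "?r < 1" "norm z < 1" using z by auto
    have "(\<lambda>m. fps_nth D m * z ^ m) sums eval_fps D z"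
      using D by (intro sums_eval_fps) simp
    hence s: "(\<lambda>m. fps_nth D (Suc m) * z ^ Suc m) sums (eval_fps D z - ?d)"
      using sums_Suc_iff[of "\<lambda>m. fps_nth D m * z ^ m" "eval_fps D z - ?d"] by simp
    have "(\<lambda>m. 3 * norm ?d * ?r * ?r ^ m) sums (3 * norm ?d * ?r * (1 / (1 - ?r)))"
      using r by (intro sums_mult geometric_sums) simp
    hence g: "(\<lambda>m. 3 * norm ?d * ?r ^ Suc m) sums (3 * norm ?d * (?r / (1 - ?r)))"
      by (simp add: mult_ac)
    have "norm (eval_fps D z - ?d) \<le> (\<Sum>m. 3 * norm ?d * ?r ^ Suc m)"
      unfolding sums_unique[OF s]
    proof (rule norm_suminf_le[OF _ sums_summable[OF g]])
      fix m
      show "norm (fps_nth D (Suc m) * z ^ Suc m) \<le> 3 * norm ?d * ?r ^ Suc m"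
        using mult_right_mono[OF bnd[of m], of "norm z ^ Suc m"]
        by (simp add: norm_mult norm_power power_divide)
    qed
    also have "\<dots> = 3 * norm ?d * (?r / (1 - ?r))" using sums_unique[OF g] by simp
    also have "3 * norm ?d * (?r / (1 - ?r)) < norm ?d"
    proof -
      have "3 * (?r / (1 - ?r)) < 1" using r by (simp add: divide_simps)
      thus ?thesis using mult_strict_left_mono[of "3 * (?r / (1 - ?r))" 1 "norm ?d"] D(2) by (simp add: mult_ac)
    qed
    finally have "norm (eval_fps D z / ?d - 1) < 1"
      using D(2) by (simp add: divide_simps norm_divide diff_divide_distrib[symmetric])
    thus ?thesis using abs_Re_le_cmod[of "eval_fps D z / ?d - 1"] by simp
  qed
  define \<phi> where "\<phi> = (\<lambda>z. ?d * z)"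
  have dphi: "deriv \<phi> z = ?d" for z
    unfolding \<phi>_def by (intro DERIV_imp_deriv) (auto intro!: derivative_eq_intros)
  have dh: "deriv h z = eval_fps D z" for z by (rule DERIV_imp_deriv[OF h])
  have "\<phi> ` ball 0 1 = (*) ?d ` ball 0 1" by (simp add: \<phi>_def)
  hence "convex (\<phi> ` ball 0 1)"
    using convex_linear_image[OF linear_times, of "ball 0 1" ?d] by simp
  moreover have "\<phi> holomorphic_on ball 0 1" unfolding \<phi>_def by (intro holomorphic_intros)
  moreover have "inj_on \<phi> (ball 0 1)" using D by (auto simp: \<phi>_def inj_on_def)
  moreover have "h holomorphic_on ball 0 1"
    using h by (auto simp: holomorphic_on_open)
  ultimately show "close_to_convex_in_disk h"
    unfolding close_to_convex_in_disk_def using pos by (auto simp: dphi dh)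
  show "inj_on h (ball 0 1)"
  proof (rule inj_onI, rule ccontr)
    fix x y assume xy: "x \<in> ball 0 1" "y \<in> ball 0 1" "h x = h y" "x \<noteq> y"
    have "Re ((h y / ?d - h x / ?d) / (y - x)) > 0"
      by (rule Re_difference_quotient_pos[of "ball 0 1" "\<lambda>z. h z / ?d" "\<lambda>z. eval_fps D z / ?d"])
         (use xy pos D h in \<open>auto intro!: derivative_eq_intros\<close>)
    thus False using xy by simp
  qed
qed

section \<open>The threshold function of an abstract Bessel quotient\<close>

text \<open>
  With \<open>q(\<mu>) = J\<^bsub>\<mu>+1\<^esub>(1) / J\<^bsub>\<mu>\<^esub>(1)\<close>, the difference of the two sides of the threshold equation is this
  expression times \<open>(2 - q(\<mu>)) J\<^bsub>\<mu>\<^esub>(1)\<close>.  Dividing by \<open>2 - q(\<mu>)\<close> makes \<open>c\<close>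
  an additive constant, so that monotonicity can be checked separately for the parts belonging to \<open>a\<close> and to
  \<open>b - a\<close>, the coefficients of \<open>\<mu>\<^sup>2\<close> and \<open>\<mu>\<close> in \<open>Q(\<mu>)\<close>.
\<close>

definition threshold_fun :: "real \<Rightarrow> real \<Rightarrow> real \<Rightarrow> (real \<Rightarrow> real) \<Rightarrow> real \<Rightarrow> real" where
  "threshold_fun a b c q \<mu> = a * (\<mu>\<^sup>2 - 1 - 2 / (2 - q \<mu>)) + (b - a) * (2 - \<mu> + (4 * \<mu> - 5) / (2 - q \<mu>)) + c"

lemma threshold_fun_eq:
  assumes "q \<mu> \<noteq> (2::real)"
  shows "(2 - q \<mu>) * threshold_fun a b c q \<mu> =
     (2 * a * \<mu>\<^sup>2 - 2 * a * \<mu> + 2 * b * \<mu> - 3 * a - b + 2 * c)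
     - (a * \<mu>\<^sup>2 + a * \<mu> - b * \<mu> - 3 * a + 2 * b + c) * q \<mu>"
proof -
  define i where "i = 1 / (2 - q \<mu>)"
  have i: "(2 - q \<mu>) * i = 1" using assms by (simp add: i_def)
  have d: "x / (2 - q \<mu>) = x * i" for x by (simp add: i_def)
  have "(2 - q \<mu>) * threshold_fun a b c q \<mu> = a * ((2 - q \<mu>) * (\<mu>\<^sup>2 - 1) - 2 * ((2 - q \<mu>) * i))
    + (b - a) * ((2 - q \<mu>) * (2 - \<mu>) + (4 * \<mu> - 5) * ((2 - q \<mu>) * i)) + c * (2 - q \<mu>)"
    unfolding threshold_fun_def d by (simp add: algebra_simps)
  thus ?thesis unfolding i by (simp add: algebra_simps power2_eq_square)
qed

text \<open>
  The recurrence is the three-term recurrence of the Bessel functions at the point 1.  Together with the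
  crude bounds it determines all quantitative properties of the quotient that are needed here.
\<close>

locale bessel_quotient =
  fixes q :: "real \<Rightarrow> real"
  assumes q_pos: "\<mu> \<ge> 0 \<Longrightarrow> q \<mu> > 0"
    and q_le: "\<mu> \<ge> 0 \<Longrightarrow> q \<mu> \<le> 1"
    and q_rec: "\<mu> \<ge> 0 \<Longrightarrow> q \<mu> * (2 * (\<mu> + 1) - q (\<mu> + 1)) = 1"
begin

lemma q_upper:
  assumes "\<mu> \<ge> 0"
  shows "q \<mu> * (2 * \<mu> + 1) \<le> 1"
proof -
  have "q \<mu> * (2 * \<mu> + 1) \<le> q \<mu> * (2 * (\<mu> + 1) - q (\<mu> + 1))"
    using assms q_pos[of \<mu>] q_le[of "\<mu> + 1"] by (intro mult_left_mono) auto
  thus ?thesis using q_rec[OF assms] by simp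
qed

lemma q_lower:
  assumes "\<mu> \<ge> 0"
  shows "q \<mu> * (2 * (\<mu> + 1)) > 1"
proof -
  have "q \<mu> * (2 * (\<mu> + 1)) > q \<mu> * (2 * (\<mu> + 1) - q (\<mu> + 1))"
    using assms q_pos[of \<mu>] q_pos[of "\<mu> + 1"] by (intro mult_strict_left_mono) auto
  thus ?thesis using q_rec[OF assms] by simp
qed

lemma q_le_third:
  assumes "\<mu> \<ge> 1"
  shows "q \<mu> \<le> 1 / 3"
proof -
  have "q \<mu> * 3 \<le> q \<mu> * (2 * \<mu> + 1)"
    using assms q_pos[of \<mu>] by (intro mult_left_mono) auto
  thus ?thesis using q_upper[of \<mu>] assms by linarith
qed

lemma q_le_three_fifths:
  assumes "\<mu> \<ge> 0"
  shows "q \<mu> \<le> 3 / 5"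
proof -
  have "q \<mu> * (5 / 3) \<le> q \<mu> * (2 * (\<mu> + 1) - q (\<mu> + 1))"
    using assms q_pos[of \<mu>] q_le_third[of "\<mu> + 1"] by (intro mult_left_mono) auto
  thus ?thesis using q_rec[OF assms] by simp
qed

lemma q_diff:
  assumes "x \<ge> 0" "y \<ge> 0"
  shows "q x - q y = q x * q y * (2 * (y - x) + (q (x + 1) - q (y + 1)))"
proof -
  have "q x * q y * (2 * (y - x) + (q (x + 1) - q (y + 1)))
      = q x * (q y * (2 * (y + 1) - q (y + 1))) - q y * (q x * (2 * (x + 1) - q (x + 1)))"
    by (simp add: algebra_simps)
  thus ?thesis using q_rec assms by simp
qed

text \<open>
  The recurrence expresses the difference of \<open>q\<close> at two orders by \<open>2 (y - x)\<close> and the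
  difference at the next orders, times \<open>q(x) q(y) \<le> 1/9\<close>.  Iterating \<open>N\<close> times leaves an unknown
  term that is at most \<open>(1/9)\<^sup>N\<close>; the constant 1/4 is the fixed point of \<open>C = (2 + C) / 9\<close>.
\<close>

lemma q_diff_bounds_shifted:
  assumes "1 \<le> x" "x \<le> y"
  shows "0 \<le> q x - q y" "q x - q y \<le> (y - x) / 4"
proof -
  have le: "q x * q y \<le> 1 / 9" "0 \<le> q x * q y" if "1 \<le> x" "1 \<le> y" for x y
    using mult_mono[of "q x" "1/3" "q y" "1/3"] q_le_third[of x] q_le_third[of y] q_pos[of x] q_pos[of y] that
    by (auto simp: less_imp_le)
  define e :: "nat \<Rightarrow> real" where "e N = (1/9) ^ N" for N
  have e_Suc: "e (Suc N) = 1 / 9 * e N" and e0: "e 0 = 1" and e_nonneg: "0 \<le> e N" for N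
    by (simp_all add: e_def)
  have *: "\<forall>x y. 1 \<le> x \<and> x \<le> y \<longrightarrow> - e N \<le> q x - q y \<and> q x - q y \<le> (y - x) / 4 + e N" for N
  proof (induction N)
    case 0
    have "-1 \<le> q x - q y \<and> q x - q y \<le> (y - x) / 4 + 1" if "1 \<le> x \<and> x \<le> y" for x y
    proof -
      have "0 < q x" "0 < q y" "q x \<le> 1" "q y \<le> 1" using that by (auto intro!: q_pos q_le)
      hence "-1 \<le> q x - q y" "q x - q y \<le> 1" by linarith+
      moreover have "0 \<le> (y - x) / 4" using that by simp
      ultimately show ?thesis by linarith
    qed
    thus ?case by (auto simp: e0)
  next
    case (Suc N)
    show ?case
    proof (intro allI impI)
      fix x y :: real assume xy: "1 \<le> x \<and> x \<le> y"
      define D where "D = 2 * (y - x) + (q (x + 1) - q (y + 1))"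
      have D: "- e N \<le> D" "D \<le> 9 / 4 * (y - x) + e N"
      proof -
        have IH: "- e N \<le> q (x + 1) - q (y + 1)"
          "q (x + 1) - q (y + 1) \<le> (y - x) / 4 + e N"
          using Suc[rule_format, of "x + 1" "y + 1"] xy by simp_all
        have "x \<le> y" using xy ..
        show "- e N \<le> D" unfolding D_def using IH(1) \<open>x \<le> y\<close> by simp
        show "D \<le> 9 / 4 * (y - x) + e N" unfolding D_def using IH(2) \<open>x \<le> y\<close> by linarith
      qed
      have p: "q x * q y \<le> 1 / 9" "0 \<le> q x * q y" using le[of x y] xy by (meson order_trans)+
      have step: "q x - q y = q x * q y * D"
        unfolding D_def using xy by (intro q_diff) auto
      have "- e (Suc N) \<le> q x * q y * (- e N)"
        using mult_right_mono[OF p(1), of "e N"] e_nonneg by (simp add: e_Suc)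
      also have "\<dots> \<le> q x * q y * D" using D(1) p(2) by (rule mult_left_mono)
      finally have 1: "- e (Suc N) \<le> q x - q y" unfolding step .
      have "q x * q y * D \<le> q x * q y * (9 / 4 * (y - x) + e N)"
        using D(2) p(2) by (rule mult_left_mono)
      also have "\<dots> \<le> 1 / 9 * (9 / 4 * (y - x) + e N)"
        using xy e_nonneg[of N] by (intro mult_right_mono[OF p(1)]) simp
      also have "\<dots> = (y - x) / 4 + e (Suc N)" by (simp add: e_Suc algebra_simps)
      finally show "- e (Suc N) \<le> q x - q y \<and> q x - q y \<le> (y - x) / 4 + e (Suc N)"
        using 1 unfolding step by blast
    qed
  qed
  have lim: "e \<longlonglongrightarrow> 0" unfolding e_def by (intro LIMSEQ_power_zero) simp
  have "- e N \<le> q x - q y" for N using *[of N] assms by blast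
  hence "- 0 \<le> q x - q y" by (intro LIMSEQ_le_const2[OF tendsto_minus[OF lim]]) auto
  thus "0 \<le> q x - q y" by simp
  have "q x - q y \<le> (y - x) / 4 + e N" for N using *[of N] assms by blast
  hence "q x - q y \<le> (y - x) / 4 + 0"
    by (intro LIMSEQ_le_const[OF tendsto_add[OF tendsto_const lim]]) auto
  thus "q x - q y \<le> (y - x) / 4" by simp
qed

lemma q_diff_bounds:
  assumes "0 \<le> x" "x \<le> y"
  shows "0 \<le> q x - q y" "q x - q y \<le> 9 / 4 * (q x * q y) * (y - x)"
proof -
  have p: "0 \<le> q x * q y" using assms q_pos[of x] q_pos[of y] by (simp add: less_imp_le)
  have d: "0 \<le> q (x + 1) - q (y + 1)" "q (x + 1) - q (y + 1) \<le> (y - x) / 4"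
    using q_diff_bounds_shifted[of "x + 1" "y + 1"] assms by auto
  have e: "q x - q y = q x * q y * (2 * (y - x) + (q (x + 1) - q (y + 1)))"
    using assms by (intro q_diff) auto
  show "0 \<le> q x - q y" unfolding e using d assms by (intro mult_nonneg_nonneg[OF p]) auto
  have "2 * (y - x) + (q (x + 1) - q (y + 1)) \<le> 9 / 4 * (y - x)" using d by linarith
  from mult_left_mono[OF this p] have "q x - q y \<le> q x * q y * (9 / 4 * (y - x))" unfolding e .
  also have "\<dots> = 9 / 4 * (q x * q y) * (y - x)" by simp
  finally show "q x - q y \<le> 9 / 4 * (q x * q y) * (y - x)" .
qed

lemma continuous_on_q: "continuous_on {0..} q"
proof (rule lipschitz_on_continuous_on)
  have "\<bar>q x - q y\<bar> \<le> 9 / 4 * \<bar>x - y\<bar>" if "0 \<le> x" "x \<le> y" for x y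
  proof -
    have "q x * q y \<le> 1 * 1" using that q_le[of x] q_le[of y] q_pos[of x] q_pos[of y] by (intro mult_mono) auto
    hence "9 / 4 * (q x * q y) * (y - x) \<le> 9 / 4 * 1 * (y - x)" using that by (intro mult_right_mono) auto
    thus ?thesis using q_diff_bounds[OF that] that by simp
  qed
  note le = this
  have "\<bar>q x - q y\<bar> \<le> 9 / 4 * \<bar>x - y\<bar>" if "0 \<le> x" "0 \<le> y" for x y
    using le[of x y] le[of y x] that by (cases "x \<le> y") (auto simp: abs_minus_commute)
  thus "(9/4)-lipschitz_on {0..} q"
    by (intro lipschitz_onI) (auto simp: dist_real_def)
qed

lemma continuous_on_threshold_fun: "continuous_on {0..} (threshold_fun a b c q)"
proof -
  have "2 - q x \<noteq> 0" if "x \<ge> 0" for x using q_le[OF that] by auto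
  thus ?thesis unfolding threshold_fun_def
    by (intro continuous_intros continuous_on_q) auto
qed

lemma inverse_two_minus_q_diff:
  assumes "0 \<le> x" "0 \<le> y"
  shows "1 / (2 - q x) - 1 / (2 - q y) = (q x - q y) / ((2 - q x) * (2 - q y))"
proof -
  have "q x \<noteq> 2" "q y \<noteq> 2" using q_le[of x] q_le[of y] assms by auto
  thus ?thesis by (simp add: divide_simps)
qed

lemma threshold_quadratic_part_strict_mono:
  assumes "0 \<le> x" "x < y"
  shows "x\<^sup>2 - 1 - 2 / (2 - q x) < y\<^sup>2 - 1 - 2 / (2 - q y)"
proof -
  have "x\<^sup>2 < y\<^sup>2" using assms by (intro power_strict_mono) auto
  moreover have "2 / (2 - q y) \<le> 2 / (2 - q x)"
    using q_diff_bounds[of x y] assms q_le[of x] q_le[of y] by (intro divide_left_mono mult_pos_pos) auto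
  ultimately show ?thesis by simp
qed

text \<open>
  The main term grows at least like \<open>y - x\<close>.  The error due to the decrease of \<open>q\<close> has a harmful sign only
  if \<open>4 x > 5\<close>, and there \<open>q(x) \<le> 1 / (2 x + 1)\<close> makes it smaller than the main term.
\<close>

lemma threshold_linear_part_strict_mono:
  assumes "0 \<le> x" "x < y"
  shows "2 - x + (4 * x - 5) / (2 - q x) < 2 - y + (4 * y - 5) / (2 - q y)"
proof -
  define d where "d = y - x"
  define \<Delta> where "\<Delta> = (q x - q y) / ((2 - q x) * (2 - q y))"
  have d: "d > 0" "y = x + d" using assms by (auto simp: d_def)
  have b: "0 < q x" "0 < q y" "q x \<le> 1" "q y \<le> 1"
    using assms by (auto intro: q_pos q_le)
  have n: "2 - q x \<noteq> 0" "2 - q y \<noteq> 0" using b by auto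
  have i: "1 / (2 - q x) = 1 / (2 - q y) + \<Delta>"
    using inverse_two_minus_q_diff[of x y] assms by (simp add: \<Delta>_def)
  have t: "2 - z + (4 * z - 5) / (2 - q z) = 2 - z + (4 * z - 5) * (1 / (2 - q z))"
    and t': "4 / (2 - q z) = 4 * (1 / (2 - q z))" for z by simp_all
  have e: "(2 - y + (4 * y - 5) / (2 - q y)) - (2 - x + (4 * x - 5) / (2 - q x))
      = d * (4 / (2 - q y) - 1) - (4 * x - 5) * \<Delta>"
    unfolding t t' i by (simp add: d_def algebra_simps diff_divide_distrib)
  have "4 / (2 - q y) \<ge> 2" using b by (simp add: field_simps)
  hence f: "d * (4 / (2 - q y) - 1) \<ge> d * 1" using d by (intro mult_left_mono) auto
  have D0: "0 \<le> \<Delta>" using q_diff_bounds[of x y] assms b by (simp add: \<Delta>_def)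
  have "(4 * x - 5) * \<Delta> < d"
  proof (cases "4 * x - 5 \<le> 0")
    case True
    hence "(4 * x - 5) * \<Delta> \<le> 0" using D0 by (simp add: mult_nonpos_nonneg)
    thus ?thesis using d by linarith
  next
    case False
    have "1 * 1 \<le> (2 - q x) * (2 - q y)" using b by (intro mult_mono) auto
    hence "\<Delta> \<le> (q x - q y) / 1"
      unfolding \<Delta>_def using q_diff_bounds[of x y] assms by (intro divide_left_mono) auto
    also have "\<dots> \<le> 9 / 4 * (q x * q y) * d" using q_diff_bounds[of x y] assms by (simp add: d_def)
    also have "\<dots> \<le> 9 / 4 * (q x * q x) * d"
      using q_diff_bounds[of x y] assms b d by (intro mult_left_mono mult_right_mono) auto
    finally have "(4 * x - 5) * \<Delta> \<le> (4 * x - 5) * (9 / 4 * (q x * q x) * d)"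
      using False by (intro mult_left_mono) auto
    also have "\<dots> = (9 / 4 * d) * ((4 * x - 5) * (q x * q x))" by simp
    also have "(4 * x - 5) * (q x * q x) \<le> 1 / 7 * ((q x * (2 * x + 1)) * (q x * (2 * x + 1)))"
    proof -
      \<comment> \<open>The quotient \<open>(4 x - 5) / (2 x + 1)\<^sup>2\<close> is largest at \<open>x = 3\<close>, where it is 1/7.\<close>
      have "0 \<le> (2 * x - 6)\<^sup>2" by simp
      hence "4 * x - 5 \<le> 1 / 7 * ((2 * x + 1) * (2 * x + 1))"
        by (simp add: power2_eq_square algebra_simps)
      from mult_right_mono[OF this, of "q x * q x"] show ?thesis by (simp add: algebra_simps)
    qed
    also have "(q x * (2 * x + 1)) * (q x * (2 * x + 1)) \<le> 1 * 1"
      using q_upper[of x] assms b by (intro mult_mono) auto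
    finally have "(4 * x - 5) * \<Delta> \<le> 9 / 28 * d" using d by simp
    thus ?thesis using d by linarith
  qed
  thus ?thesis using e f by linarith
qed

lemma threshold_strict_mono_nonneg:
  assumes "a \<ge> 0" "b > a" "0 \<le> x" "x < y"
  shows "threshold_fun a b c q x < threshold_fun a b c q y"
proof -
  have "a * (x\<^sup>2 - 1 - 2 / (2 - q x)) \<le> a * (y\<^sup>2 - 1 - 2 / (2 - q y))"
    using threshold_quadratic_part_strict_mono[of x y] assms by (intro mult_left_mono) auto
  moreover have "(b - a) * (2 - x + (4 * x - 5) / (2 - q x)) < (b - a) * (2 - y + (4 * y - 5) / (2 - q y))"
    using threshold_linear_part_strict_mono[of x y] assms by (intro mult_strict_left_mono) auto
  ultimately show ?thesis by (simp add: threshold_fun_def)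
qed

text \<open>
  The error due to the decrease of \<open>q\<close> has the favourable sign, because \<open>2 + 4 s x - 5 s\<close> is positive for
  \<open>x \<ge> s\<close>.  The main term is controlled by \<open>q \<le> 3/5\<close>.
\<close>

lemma threshold_strict_mono_two_roots:
  assumes "a > 0" "b = a * (1 - s)" "0 < s" "s \<le> x" "x < y"
  shows "threshold_fun a b 0 q x < threshold_fun a b 0 q y"
proof -
  define d where "d = y - x"
  define \<Delta> where "\<Delta> = (q x - q y) / ((2 - q x) * (2 - q y))"
  have d: "d > 0" "y = x + d" using assms by (auto simp: d_def)
  have b: "0 < q x" "0 < q y" "q x \<le> 1" "q y \<le> 3 / 5"
    using assms q_le_three_fifths[of y] by (auto intro: q_pos q_le)
  have n: "2 - q x \<noteq> 0" "2 - q y \<noteq> 0" using b by auto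
  have t: "threshold_fun a b 0 q z = a * (z\<^sup>2 + s * z - 1 - 2 * s - (2 + 4 * s * z - 5 * s) * (1 / (2 - q z)))" for z
    unfolding threshold_fun_def assms(2) by (simp add: algebra_simps diff_divide_distrib add_divide_distrib)
  have i: "1 / (2 - q x) = 1 / (2 - q y) + \<Delta>"
    using inverse_two_minus_q_diff[of x y] assms by (simp add: \<Delta>_def)
  have "threshold_fun a b 0 q y - threshold_fun a b 0 q x = a * (d * (x + y + s - 4 * s * (1 / (2 - q y))) + (2 + 4 * s * x - 5 * s) * \<Delta>)"
    unfolding t i by (simp add: d(2) power2_eq_square algebra_simps)
  moreover have "(2 + 4 * s * x - 5 * s) * \<Delta> \<ge> 0"
  proof (intro mult_nonneg_nonneg)
    have "s * x \<ge> s * s" using assms by simp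
    \<comment> \<open>The square shows that \<open>2 + 4 s\<^sup>2 - 5 s > 0\<close>.\<close>
    moreover have "0 \<le> (2 * s - 5 / 4)\<^sup>2" by simp
    ultimately show "2 + 4 * s * x - 5 * s \<ge> 0" by (simp add: power2_eq_square algebra_simps)
    show "\<Delta> \<ge> 0" using q_diff_bounds[of x y] assms b by (simp add: \<Delta>_def)
  qed
  moreover have "d * (x + y + s - 4 * s * (1 / (2 - q y))) > 0"
  proof (intro mult_pos_pos d(1))
    have "1 / (2 - q y) \<le> 5 / 7" using b by (simp add: field_simps)
    hence "4 * s * (1 / (2 - q y)) \<le> 4 * s * (5 / 7)" using assms by (intro mult_left_mono) auto
    thus "x + y + s - 4 * s * (1 / (2 - q y)) > 0" using assms by simp
  qed
  ultimately have "threshold_fun a b 0 q y - threshold_fun a b 0 q x > 0" using assms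
    by (simp add: add_pos_nonneg)
  thus ?thesis by simp
qed

text \<open>
  By the recurrence, the linear part equals \<open>x - q(x) (4 - q(x + 1)) / (2 - q(x))\<close>.
\<close>

lemma linear_part_bounds:
  assumes "x \<ge> 0"
  shows "x - 4 \<le> 2 - x + (4 * x - 5) / (2 - q x)" "2 - x + (4 * x - 5) / (2 - q x) \<le> x"
proof -
  have b: "0 < q x" "q x \<le> 1" "0 < q (x + 1)" "q (x + 1) \<le> 1" using assms by (auto intro: q_pos q_le)
  have r: "q x * (2 * (x + 1) - q (x + 1)) = 1" using q_rec assms by simp
  have e: "2 - x + (4 * x - 5) / (2 - q x) = x - q x * (4 - q (x + 1)) / (2 - q x)"
    using b r by (simp add: field_simps)
  show "2 - x + (4 * x - 5) / (2 - q x) \<le> x" unfolding e using b by simp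
  have "q x * (4 - q (x + 1)) \<le> 1 * 4" using b by (intro mult_mono) auto
  hence "q x * (4 - q (x + 1)) / (2 - q x) \<le> 4 / 1" using b by (intro frac_le) auto
  thus "x - 4 \<le> 2 - x + (4 * x - 5) / (2 - q x)" unfolding e by simp
qed

lemma threshold_root_exists_nonneg:
  assumes "a \<ge> 0" "b > a"
  shows "\<exists>\<rho>>0. threshold_fun a b 0 q \<rho> = 0"
proof -
  have b: "0 < q 0" "q 0 \<le> 1" "q 5 \<le> 1" by (auto intro: q_pos q_le)
  have "0 \<le> 2 / (2 - q 0)" using b by simp
  hence "0\<^sup>2 - 1 - 2 / (2 - q 0) \<le> 0" unfolding power2_eq_square by linarith
  hence "a * (0\<^sup>2 - 1 - 2 / (2 - q 0)) \<le> 0" using assms by (intro mult_nonneg_nonpos) auto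
  moreover have "2 - 0 + (4 * 0 - 5) / (2 - q 0) < 0" using b by (simp add: field_simps)
  hence "(b - a) * (2 - 0 + (4 * 0 - 5) / (2 - q 0)) < 0" using assms by (intro mult_pos_neg) auto
  ultimately have 0: "threshold_fun a b 0 q 0 < 0" unfolding threshold_fun_def by simp
  have "2 / (2 - q 5) \<le> 2 / 1" using b by (intro frac_le) auto
  hence "a * (5\<^sup>2 - 1 - 2 / (2 - q 5)) \<ge> 0" using assms by (intro mult_nonneg_nonneg) auto
  moreover have "(b - a) * (2 - 5 + (4 * 5 - 5) / (2 - q 5)) > 0"
    using assms linear_part_bounds[of 5] by (intro mult_pos_pos) auto
  ultimately have 5: "threshold_fun a b 0 q 5 > 0" unfolding threshold_fun_def by linarith
  have "continuous_on {0..5} (threshold_fun a b 0 q)"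
    by (rule continuous_on_subset[OF continuous_on_threshold_fun]) auto
  from IVT'[OF less_imp_le[OF 0] less_imp_le[OF 5] _ this] obtain \<rho> where "0 \<le> \<rho>" "threshold_fun a b 0 q \<rho> = 0" by auto
  thus ?thesis using 0 by (intro exI[of _ \<rho>]) (auto simp: less_le)
qed

text \<open>
  The sign at \<open>s\<close> is decided by \<open>1 / (2 (s + 1)) < q(s) \<le> 1\<close>: the lower bound is needed when
  \<open>2 s\<^sup>2 - 2 s - 1\<close> is nonnegative, the upper bound otherwise.
\<close>

lemma threshold_root_exists_two_roots:
  assumes "a > 0" "b = a * (1 - s)" "0 < s"
  shows "\<exists>\<rho>>s. threshold_fun a b 0 q \<rho> = 0"
proof -
  have b: "0 < q s" "q s \<le> 1" "q (s + 2) \<le> 1" using assms by (auto intro: q_pos q_le)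
  have "s - 4 < q s * (2 * s\<^sup>2 - 2 * s - 1)"
  proof (cases "2 * s\<^sup>2 - 2 * s - 1 \<ge> 0")
    case True
    have "s - 4 < 1 / (2 * (s + 1)) * (2 * s\<^sup>2 - 2 * s - 1)"
      using assms by (simp add: field_simps power2_eq_square)
    also have "\<dots> \<le> q s * (2 * s\<^sup>2 - 2 * s - 1)"
      using q_lower[of s] assms True by (intro mult_right_mono) (simp_all add: field_simps)
    finally show ?thesis .
  next
    case False
    have "s < 2"
    proof (rule ccontr)
      assume "\<not> s < 2"
      hence "s * (s - 1) \<ge> 2 * 1" by (intro mult_mono) auto
      thus False using False by (simp add: power2_eq_square algebra_simps)
    qed
    have "0 \<le> (2 * s - 1)\<^sup>2" by simp
    hence "2 * s\<^sup>2 - 2 * s - 1 \<ge> - 3 / 2" by (simp add: power2_eq_square algebra_simps)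
    have "s - 4 < 1 * (- 3 / 2)" using \<open>s < 2\<close> by simp
    also have "\<dots> \<le> 1 * (2 * s\<^sup>2 - 2 * s - 1)" using \<open>_ \<ge> - 3 / 2\<close> by simp
    also have "\<dots> \<le> q s * (2 * s\<^sup>2 - 2 * s - 1)" using False b by (intro mult_right_mono_neg) auto
    finally show ?thesis .
  qed
  moreover have "(2 - q s) * threshold_fun a b 0 q s = a * (s - 4 - q s * (2 * s\<^sup>2 - 2 * s - 1))"
    using b by (subst threshold_fun_eq) (auto simp: assms(2) algebra_simps power2_eq_square)
  ultimately have "(2 - q s) * threshold_fun a b 0 q s < 0" using assms by (simp add: mult_pos_neg)
  hence 0: "threshold_fun a b 0 q s < 0" using b by (simp add: mult_less_0_iff)
  define A B where "A = (s + 2)\<^sup>2 - 1 - 2 / (2 - q (s + 2))"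
    and "B = 2 - (s + 2) + (4 * (s + 2) - 5) / (2 - q (s + 2))"
  have "2 / (2 - q (s + 2)) \<le> 2 / 1" using b by (intro frac_le) auto
  moreover have "s * B \<le> s * (s + 2)"
    unfolding B_def using linear_part_bounds[of "s + 2"] assms by (intro mult_left_mono) auto
  ultimately have "A - s * B > 0"
    using assms by (simp add: A_def power2_eq_square algebra_simps)
  hence "a * (A - s * B) > 0" using assms by simp
  moreover have "threshold_fun a b 0 q (s + 2) = a * A + (b - a) * B"
    unfolding threshold_fun_def A_def B_def by simp
  ultimately have 5: "threshold_fun a b 0 q (s + 2) > 0" unfolding assms(2) by (simp add: algebra_simps)
  have "continuous_on {s..s + 2} (threshold_fun a b 0 q)"
    by (rule continuous_on_subset[OF continuous_on_threshold_fun]) (use assms in auto)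
  from IVT'[OF less_imp_le[OF 0] less_imp_le[OF 5] _ this] obtain \<rho> where "s \<le> \<rho>" "threshold_fun a b 0 q \<rho> = 0" by auto
  thus ?thesis using 0 by (intro exI[of _ \<rho>]) (auto simp: less_le)
qed

end

section \<open>Values of the Bessel series on the real axis\<close>

lemma radius_mult: "fps_conv_radius f = \<infinity> \<Longrightarrow> fps_conv_radius g = \<infinity> \<Longrightarrow> fps_conv_radius (f * g) = \<infinity>"
  for f g :: "complex fps"
  using fps_conv_radius_mult[of f g] by simp

lemma radius_add: "fps_conv_radius f = \<infinity> \<Longrightarrow> fps_conv_radius g = \<infinity> \<Longrightarrow> fps_conv_radius (f + g) = \<infinity>"
  for f g :: "complex fps"
  using fps_conv_radius_add[of f g] by simp

lemma radius_diff: "fps_conv_radius f = \<infinity> \<Longrightarrow> fps_conv_radius g = \<infinity> \<Longrightarrow> fps_conv_radius (f - g) = \<infinity>"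
  for f g :: "complex fps"
  using fps_conv_radius_diff[of f g] by simp

lemma radius_deriv: "fps_conv_radius f = \<infinity> \<Longrightarrow> fps_conv_radius (fps_deriv f) = \<infinity>"
  for f :: "complex fps"
  using fps_conv_radius_deriv[of f] by simp

text \<open>
  The Leibniz criterion, stopped after one and after two terms.
\<close>

lemma eval_alt_fps_bounds:
  assumes rad: "fps_conv_radius (alt_fps c) = \<infinity>"
    and pos: "\<And>n. c n > 0" and dec: "\<And>n. c (Suc n) \<le> c n"
    and r: "0 \<le> r" "r \<le> 1"
  obtains y where "eval_fps (alt_fps c) (of_real r) = of_real y" "c 0 - c 1 \<le> y" "y \<le> c 0"
proof -
  define a where "a = (\<lambda>n. c n * r ^ n)"
  define y where "y = (\<Sum>n. (-1) ^ n * a n)"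
  have "(\<lambda>n. fps_nth (alt_fps c) n * of_real r ^ n) sums eval_fps (alt_fps c) (of_real r)"
    using rad by (intro sums_eval_fps) simp
  also have "(\<lambda>n. fps_nth (alt_fps c) n * of_real r ^ n) = (\<lambda>n. complex_of_real ((-1) ^ n * a n))"
    by (simp add: alt_fps_def a_def mult_ac)
  finally have s: "(\<lambda>n. complex_of_real ((-1) ^ n * a n)) sums eval_fps (alt_fps c) (of_real r)" .
  hence "(\<lambda>n. Re (complex_of_real ((-1) ^ n * a n))) sums Re (eval_fps (alt_fps c) (of_real r))"
    by (rule sums_Re)
  hence sr: "(\<lambda>n. (-1) ^ n * a n) sums Re (eval_fps (alt_fps c) (of_real r))" by simp
  hence e: "eval_fps (alt_fps c) (of_real r) = of_real y"
    using sums_unique2[OF s sums_of_real[OF sr]] sums_unique[OF sr] by (simp add: y_def)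
  have a0: "a \<longlonglongrightarrow> 0"
    using tendsto_rabs_zero[OF summable_LIMSEQ_zero[OF sums_summable[OF sr]]] pos r
    by (simp add: abs_mult power_abs a_def less_imp_le)
  have an: "0 \<le> a n" "a (Suc n) \<le> a n" for n
  proof -
    show "0 \<le> a n" using pos[of n] r by (simp add: a_def)
    show "a (Suc n) \<le> a n" unfolding a_def
      using dec[of n] pos[of n] pos[of "Suc n"] r power_decreasing[of n "Suc n" r]
      by (intro mult_mono) auto
  qed
  have "c 0 - c 1 \<le> (\<Sum>i<2*1. (-1) ^ i * a i)"
    using pos[of 1] r mult_left_mono[of r 1 "c 1"] by (simp add: a_def numeral_2_eq_2)
  also have "\<dots> \<le> y" unfolding y_def by (rule summable_Leibniz'(2)[OF a0 an])
  finally have 1: "c 0 - c 1 \<le> y" .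
  have "y \<le> (\<Sum>i<2*0+1. (-1) ^ i * a i)" unfolding y_def by (rule summable_Leibniz'(4)[OF a0 an])
  also have "\<dots> = c 0" by (simp add: a_def)
  finally have "y \<le> c 0" .
  with that e 1 show ?thesis by blast
qed

lemma radius_j_fps [simp]:
  assumes "\<nu> \<ge> 0"
  shows "fps_conv_radius (j_fps \<nu>) = \<infinity>"
  unfolding fps_conv_radius_def
proof (rule conv_radius_inftyI'')
  fix z :: complex
  show "summable (\<lambda>n. fps_nth (j_fps \<nu>) n * z ^ n)"
  proof (rule summable_div_fact[of _ 1 1])
    fix n
    have "1 \<le> pochhammer (\<nu> + 1) n"
    proof (induction n)
      case (Suc n)
      have "1 * 1 \<le> pochhammer (\<nu> + 1) n * (\<nu> + 1 + real n)"
        using Suc assms by (intro mult_mono) auto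
      thus ?case by (simp add: pochhammer_Suc)
    qed simp
    hence "1 * fact n * 1 \<le> 4 ^ n * fact n * pochhammer (\<nu> + 1) n"
      by (intro mult_mono) (auto simp: pochhammer_nonneg assms)
    hence "j_coeff \<nu> n \<le> 1 / fact n"
      unfolding j_coeff_def using pochhammer_nu_pos[OF assms, of n] by (intro divide_left_mono) auto
    thus "norm (fps_nth (j_fps \<nu>) n) \<le> 1 * 1 ^ n / fact n"
      using j_coeff_pos[OF assms, of n] by (simp add: j_fps_def alt_fps_def norm_mult norm_power)
  qed
qed

definition j_one :: "real \<Rightarrow> real" where
  "j_one \<nu> = Re (eval_fps (j_fps \<nu>) 1)"

lemma j_coeff_decreasing:
  assumes "\<nu> \<ge> 0"
  shows "4 * j_coeff \<nu> (Suc n) \<le> j_coeff \<nu> n"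
proof -
  have "4 * j_coeff \<nu> (Suc n) * (1 * 1) \<le> 4 * j_coeff \<nu> (Suc n) * (real (Suc n) * (\<nu> + real (Suc n)))"
    using assms j_coeff_pos[OF assms, of "Suc n"] by (intro mult_left_mono mult_mono) auto
  also have "\<dots> = j_coeff \<nu> n"
    using j_coeff_Suc[OF assms, of n] by (simp only: mult_ac)
  finally show ?thesis by simp
qed

lemma j_one:
  assumes "\<nu> \<ge> 0"
  shows "eval_fps (j_fps \<nu>) 1 = of_real (j_one \<nu>)" "3 / 4 \<le> j_one \<nu>" "j_one \<nu> \<le> 1"
proof -
  have d: "j_coeff \<nu> (Suc n) \<le> j_coeff \<nu> n" for n
    using j_coeff_decreasing[OF assms, of n] j_coeff_pos[OF assms, of "Suc n"] by linarith
  obtain y where y: "eval_fps (alt_fps (j_coeff \<nu>)) (of_real 1) = of_real y"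
      "j_coeff \<nu> 0 - j_coeff \<nu> 1 \<le> y" "y \<le> j_coeff \<nu> 0"
    by (rule eval_alt_fps_bounds[of "j_coeff \<nu>" 1])
       (use assms d j_coeff_pos[OF assms] in \<open>auto simp flip: j_fps_def\<close>)
  have "j_coeff \<nu> 0 = 1" "4 * j_coeff \<nu> 1 \<le> j_coeff \<nu> 0"
    using j_coeff_decreasing[OF assms, of 0] by (simp_all add: j_coeff_def)
  moreover have e: "eval_fps (j_fps \<nu>) 1 = of_real y" using y(1) by (simp add: j_fps_def)
  moreover have "j_one \<nu> = y" using e by (simp add: j_one_def)
  ultimately show "eval_fps (j_fps \<nu>) 1 = of_real (j_one \<nu>)" "3 / 4 \<le> j_one \<nu>" "j_one \<nu> \<le> 1"
    using y(2,3) by auto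
qed

lemma j_one_recurrence:
  assumes "\<nu> \<ge> 0"
  shows "j_one \<nu> = j_one (\<nu> + 1) - 1 / (4 * (\<nu> + 1) * (\<nu> + 2)) * j_one (\<nu> + 2)"
proof -
  have "eval_fps (j_fps \<nu>) 1 = eval_fps (j_fps (\<nu> + 1)) 1
          - of_real (1 / (4 * (\<nu> + 1) * (\<nu> + 2))) * eval_fps (j_fps (\<nu> + 2)) 1"
    using assms by (subst j_fps_recurrence[OF assms])
      (simp add: eval_fps_diff eval_fps_mult radius_mult)
  hence "complex_of_real (j_one \<nu>) = of_real (j_one (\<nu> + 1) - 1 / (4 * (\<nu> + 1) * (\<nu> + 2)) * j_one (\<nu> + 2))"
    using assms by (simp add: j_one)
  thus ?thesis by (simp only: of_real_eq_iff)
qed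

definition bessel_ratio :: "real \<Rightarrow> real" where
  "bessel_ratio \<nu> = j_one (\<nu> + 1) / (2 * (\<nu> + 1) * j_one \<nu>)"

interpretation bessel_quotient bessel_ratio
proof
  fix \<nu> :: real assume \<nu>: "\<nu> \<ge> 0"
  have j: "j_one \<nu> \<ge> 3 / 4" "j_one (\<nu> + 1) \<ge> 3 / 4" "j_one (\<nu> + 1) \<le> 1"
    using j_one[of \<nu>] j_one[of "\<nu> + 1"] \<nu> by auto
  show "bessel_ratio \<nu> > 0" using j \<nu> by (simp add: bessel_ratio_def)
  have "1 * (3 / 4) \<le> (\<nu> + 1) * j_one \<nu>" using j \<nu> by (intro mult_mono) auto
  hence "j_one (\<nu> + 1) \<le> 2 * (\<nu> + 1) * j_one \<nu>" using j unfolding mult.assoc by linarith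
  thus "bessel_ratio \<nu> \<le> 1" using j \<nu> by (simp add: bessel_ratio_def)
  have n: "\<nu> + 1 \<noteq> 0" "\<nu> + 2 \<noteq> 0" "j_one \<nu> \<noteq> 0" "j_one (\<nu> + 1) \<noteq> 0" using \<nu> j by auto
  have "2 * (\<nu> + 1) * bessel_ratio \<nu> = j_one (\<nu> + 1) / j_one \<nu>"
    using n by (simp add: bessel_ratio_def)
  moreover have "bessel_ratio \<nu> * bessel_ratio (\<nu> + 1) = 1 / (4 * (\<nu> + 1) * (\<nu> + 2)) * j_one (\<nu> + 2) / j_one \<nu>"
    using n by (simp add: bessel_ratio_def add.assoc divide_simps) (simp add: algebra_simps)
  ultimately have "2 * (\<nu> + 1) * bessel_ratio \<nu> - bessel_ratio \<nu> * bessel_ratio (\<nu> + 1)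
     = (j_one (\<nu> + 1) - 1 / (4 * (\<nu> + 1) * (\<nu> + 2)) * j_one (\<nu> + 2)) / j_one \<nu>"
    by (simp only: diff_divide_distrib)
  also have "\<dots> = 1" using j_one_recurrence[OF \<nu>] n(3) by simp
  finally show "bessel_ratio \<nu> * (2 * (\<nu> + 1) - bessel_ratio (\<nu> + 1)) = 1"
    by (simp add: algebra_simps)
qed

lemma Gamma_succ_pos: "\<nu> \<ge> 0 \<Longrightarrow> Gamma (\<nu> + 1) > (0 :: real)"
  by (rule Gamma_real_pos) simp

lemma J_coeff_eq:
  assumes "\<nu> \<ge> 0"
  shows "J_coeff \<nu> n = of_real (1 / Gamma (\<nu> + 1)) * fps_nth (j_fps \<nu>) n"
proof -
  have "\<nu> + 1 \<notin> \<int>\<^sub>\<le>\<^sub>0" using assms by (auto simp: nonpos_Ints_def)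
  hence p: "Gamma (\<nu> + 1 + real n) = Gamma (\<nu> + 1) * pochhammer (\<nu> + 1) n"
    using pochhammer_Gamma[of "\<nu> + 1" n] Gamma_succ_pos[OF assms] by simp
  have "Gamma (of_nat n + of_real \<nu> + 1 :: complex) = of_real (Gamma (\<nu> + 1 + real n))"
    by (simp add: add_ac flip: Gamma_complex_of_real)
  thus ?thesis unfolding J_coeff_def p by (simp add: j_fps_def alt_fps_def j_coeff_def mult_ac)
qed

lemma bessel_J_one:
  assumes "\<nu> \<ge> 0"
  shows "bessel_J \<nu> 1 = of_real ((1 / 2) powr \<nu> / Gamma (\<nu> + 1) * j_one \<nu>)"
proof -
  have "(\<lambda>n. fps_nth (j_fps \<nu>) n * 1 ^ n) sums eval_fps (j_fps \<nu>) 1"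
    using assms by (intro sums_eval_fps) simp
  hence "(\<lambda>n. of_real (1 / Gamma (\<nu> + 1)) * (fps_nth (j_fps \<nu>) n * 1 ^ n))
           sums (of_real (1 / Gamma (\<nu> + 1)) * eval_fps (j_fps \<nu>) 1)"
    by (rule sums_mult)
  hence "(\<Sum>n. J_coeff \<nu> n * 1 ^ (2 * n)) = of_real (1 / Gamma (\<nu> + 1)) * eval_fps (j_fps \<nu>) 1"
    by (simp add: J_coeff_eq[OF assms] sums_iff)
  moreover have "(1 / 2 :: complex) powr of_real \<nu> = of_real ((1 / 2) powr \<nu>)"
    using powr_of_real[of "1/2" \<nu>] by simp
  ultimately show ?thesis
    using bessel_J_eq[OF assms, of 1] j_one(1)[OF assms] by simp
qed

lemma bessel_J_one_Suc:
  assumes "\<nu> \<ge> 0"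
  shows "bessel_J (\<nu> + 1) 1 = of_real (bessel_ratio \<nu>) * bessel_J \<nu> 1" "bessel_J \<nu> 1 \<noteq> 0"
proof -
  have g: "Gamma (\<nu> + 1 + 1) = (\<nu> + 1) * Gamma (\<nu> + 1)"
    using assms by (intro Gamma_plus1) (auto simp: nonpos_Ints_def)
  have p: "(1 / 2 :: real) powr (\<nu> + 1) = (1 / 2) powr \<nu> / 2" by (simp add: powr_add)
  have n: "j_one \<nu> \<noteq> 0" "Gamma (\<nu> + 1) \<noteq> 0"
    using j_one[OF assms] Gamma_succ_pos[OF assms] by auto
  have "(1 / 2) powr (\<nu> + 1) / Gamma (\<nu> + 1 + 1) * j_one (\<nu> + 1)
      = bessel_ratio \<nu> * ((1 / 2) powr \<nu> / Gamma (\<nu> + 1) * j_one \<nu>)"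
    unfolding p g bessel_ratio_def using n assms by (simp add: divide_simps)
  thus "bessel_J (\<nu> + 1) 1 = of_real (bessel_ratio \<nu>) * bessel_J \<nu> 1"
    using assms by (simp add: bessel_J_one flip: of_real_mult)
  show "bessel_J \<nu> 1 \<noteq> 0" using assms n by (simp add: bessel_J_one)
qed

lemma threshold_equation_iff:
  assumes "\<mu> \<ge> 0"
  shows "threshold_equation a b c \<mu> \<longleftrightarrow> threshold_fun a b c bessel_ratio \<mu> = 0"
proof -
  let ?A = "2 * a * \<mu>\<^sup>2 - 2 * a * \<mu> + 2 * b * \<mu> - 3 * a - b + 2 * c"
  let ?B = "a * \<mu>\<^sup>2 + a * \<mu> - b * \<mu> - 3 * a + 2 * b + c"
  have n: "bessel_ratio \<mu> \<noteq> 2" using q_le[OF assms] by auto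
  have "threshold_equation a b c \<mu> \<longleftrightarrow>
      of_real ?A * bessel_J \<mu> 1 = of_real ?B * of_real (bessel_ratio \<mu>) * bessel_J \<mu> 1"
    unfolding threshold_equation_def bessel_J_one_Suc(1)[OF assms] by (simp only: mult.assoc)
  also have "\<dots> \<longleftrightarrow> complex_of_real ?A = of_real (?B * bessel_ratio \<mu>)"
    unfolding mult_right_cancel[OF bessel_J_one_Suc(2)[OF assms]] of_real_mult ..
  also have "\<dots> \<longleftrightarrow> ?A - ?B * bessel_ratio \<mu> = 0" by (simp only: of_real_eq_iff right_minus_eq)
  also have "\<dots> \<longleftrightarrow> threshold_fun a b c bessel_ratio \<mu> = 0"
    unfolding threshold_fun_eq[of bessel_ratio \<mu>, OF n, symmetric] using n by simp
  finally show ?thesis .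
qed

section \<open>The power series of the Bessel combination\<close>

definition combination_coeff :: "real \<Rightarrow> real \<Rightarrow> real \<Rightarrow> real \<Rightarrow> nat \<Rightarrow> real" where
  "combination_coeff a b c \<nu> n = Q_poly a b c (2 * real n + \<nu>) / Q_poly a b c \<nu> * j_coeff \<nu> n"

text \<open>
  This is the power series of \<open>f(z) / z\<close>, where \<open>f\<close> is the Bessel combination.
\<close>

definition combination_fps :: "real \<Rightarrow> real \<Rightarrow> real \<Rightarrow> real \<Rightarrow> complex fps" where
  "combination_fps a b c \<nu> = alt_fps (combination_coeff a b c \<nu>)"

lemma bessel_combination_sums:
  assumes "\<nu> \<ge> 0"
  shows "(\<lambda>n. z * (fps_nth (combination_fps a b c \<nu>) n * z ^ n)) sums bessel_combination a b c \<nu> z"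
proof -
  have G: "Gamma (\<nu> + 1) \<noteq> 0" using Gamma_succ_pos[OF assms] by simp
  have "of_real (Gamma (\<nu> + 1) * Q_poly a b c (2 * real n + \<nu>) / Q_poly a b c \<nu>) * J_coeff \<nu> n * z ^ (n + 1)
      = z * (fps_nth (combination_fps a b c \<nu>) n * z ^ n)" for n
    using G by (simp add: J_coeff_eq[OF assms] combination_fps_def combination_coeff_def alt_fps_def j_fps_def mult_ac)
  thus ?thesis using bessel_combination_power_series[OF assms, of a b c z] by simp
qed

lemma radius_combination_fps [simp]:
  assumes "\<nu> \<ge> 0"
  shows "fps_conv_radius (combination_fps a b c \<nu>) = \<infinity>"
  unfolding fps_conv_radius_def
proof (rule conv_radius_inftyI')
  fix r :: real assume r: "r > 0"
  have "(\<lambda>n. of_real r * (fps_nth (combination_fps a b c \<nu>) n * of_real r ^ n)) sums bessel_combination a b c \<nu> (of_real r)"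
    by (rule bessel_combination_sums[OF assms])
  hence "summable (\<lambda>n. fps_nth (combination_fps a b c \<nu>) n * of_real r ^ n)"
    using r by (simp add: sums_iff summable_cmult_iff)
  thus "\<exists>z. norm z = r \<and> summable (\<lambda>n. fps_nth (combination_fps a b c \<nu>) n * z ^ n)"
    using r by (intro exI[of _ "of_real r"]) simp
qed

lemma bessel_combination_eq:
  assumes "\<nu> \<ge> 0"
  shows "bessel_combination a b c \<nu> z = z * eval_fps (combination_fps a b c \<nu>) z"
    "bessel_combination a b c \<nu> = eval_fps (fps_X * combination_fps a b c \<nu>)"
proof -
  have *: "bessel_combination a b c \<nu> z = z * eval_fps (combination_fps a b c \<nu>) z" for z
  proof -
    have "(\<lambda>n. z * (fps_nth (combination_fps a b c \<nu>) n * z ^ n)) sums (z * eval_fps (combination_fps a b c \<nu>) z)"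
      using assms by (intro sums_mult sums_eval_fps) simp
    thus ?thesis using bessel_combination_sums[OF assms] sums_unique2 by blast
  qed
  show "bessel_combination a b c \<nu> z = z * eval_fps (combination_fps a b c \<nu>) z" by (rule *)
  show "bessel_combination a b c \<nu> = eval_fps (fps_X * combination_fps a b c \<nu>)"
    by (rule ext) (simp add: * eval_fps_mult assms)
qed

text \<open>
  The identity \<open>Q(2 n + \<nu>) = Q(\<nu>) + 4 a n (n + \<nu>) + 2 (b - a) n\<close> splits the series into three parts; the factor
  \<open>4 n (n + \<nu>)\<close> lowers the index of a Bessel coefficient, and the factor \<open>n\<close> lowers the index and raises the
  order.
\<close>

lemma combination_fps_times_Q:
  assumes "\<nu> \<ge> 0" "Q_poly a b c \<nu> \<noteq> 0"
  shows "fps_const (of_real (Q_poly a b c \<nu>)) * combination_fps a b c \<nu>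
     = (fps_const (of_real (Q_poly a b c \<nu>)) - fps_const (of_real a) * fps_X) * j_fps \<nu>
       - fps_const (of_real ((b - a) / (2 * (\<nu> + 1)))) * (fps_X * j_fps (\<nu> + 1))" (is "?L = ?R")
proof (rule fps_ext)
  fix n
  show "fps_nth ?L n = fps_nth ?R n"
  proof (cases n)
    case 0
    thus ?thesis using assms by (simp add: combination_fps_def combination_coeff_def alt_fps_def j_coeff_def left_diff_distrib mult.assoc)
  next
    case (Suc m)
    have 1: "4 * real (Suc m) * (\<nu> + real (Suc m)) * j_coeff \<nu> (Suc m) = j_coeff \<nu> m"
      by (rule j_coeff_Suc[OF assms(1)])
    have 2: "2 * real (Suc m) * j_coeff \<nu> (Suc m) = 1 / (2 * (\<nu> + 1)) * j_coeff (\<nu> + 1) m"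
      unfolding mult.assoc Suc_times_j_coeff[OF assms(1), of m] using assms(1) by (simp add: field_simps)
    have "Q_poly a b c (2 * real n + \<nu>) * j_coeff \<nu> (Suc m) = Q_poly a b c \<nu> * j_coeff \<nu> (Suc m)
         + a * (4 * real (Suc m) * (\<nu> + real (Suc m)) * j_coeff \<nu> (Suc m))
         + (b - a) * (2 * real (Suc m) * j_coeff \<nu> (Suc m))"
      unfolding Suc Q_poly_def by (simp add: algebra_simps)
    hence "Q_poly a b c (2 * real n + \<nu>) * j_coeff \<nu> (Suc m)
        = Q_poly a b c \<nu> * j_coeff \<nu> (Suc m) + a * j_coeff \<nu> m + (b - a) / (2 * (\<nu> + 1)) * j_coeff (\<nu> + 1) m"
      unfolding 1 2 by simp
    from arg_cong[OF this, of "\<lambda>x. complex_of_real ((-1) ^ n * x)"] show ?thesis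
      using assms(2)
      by (simp add: Suc combination_fps_def combination_coeff_def alt_fps_def j_fps_def left_diff_distrib mult.assoc) (simp add: algebra_simps)
  qed
qed

text \<open>
  The left-hand side is \<open>f'(1)\<close>.  The derivatives of the Bessel series are series of higher order, and the
  recurrence expresses the values of orders \<open>\<nu> + 1\<close> and \<open>\<nu> + 2\<close> at 1 by the value of order \<open>\<nu>\<close> and the
  quotient \<open>q(\<nu>)\<close>.
\<close>

lemma combination_fps_at_one:
  assumes \<nu>: "\<nu> \<ge> 0" and Q: "Q_poly a b c \<nu> \<noteq> 0"
  shows "eval_fps (combination_fps a b c \<nu>) 1 + eval_fps (fps_deriv (combination_fps a b c \<nu>)) 1
    = of_real ((2 - bessel_ratio \<nu>) * threshold_fun a b c bessel_ratio \<nu> * j_one \<nu> / (2 * Q_poly a b c \<nu>))"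
proof -
  let ?Q = "Q_poly a b c \<nu>" and ?q = "bessel_ratio \<nu>"
  let ?G = "combination_fps a b c \<nu>"
  have j: "j_one \<nu> \<noteq> 0" using j_one(2)[OF \<nu>] by linarith
  have j1: "j_one (\<nu> + 1) = 2 * (\<nu> + 1) * ?q * j_one \<nu>" using \<nu> j by (simp add: bessel_ratio_def)
  have j2: "1 / (4 * (\<nu> + 1) * (\<nu> + 2)) * j_one (\<nu> + 2) = j_one (\<nu> + 1) - j_one \<nu>"
    using j_one_recurrence[OF \<nu>] by simp
  have e0: "of_real ?Q * eval_fps ?G 1 = of_real ((?Q - a) * j_one \<nu> - (b - a) / (2 * (\<nu> + 1)) * j_one (\<nu> + 1))"
  proof -
    have "of_real ?Q * eval_fps ?G 1 = eval_fps (fps_const (of_real ?Q) * ?G) 1"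
      using \<nu> by (simp add: eval_fps_mult)
    also have "\<dots> = of_real ((?Q - a) * j_one \<nu> - (b - a) / (2 * (\<nu> + 1)) * j_one (\<nu> + 1))"
      unfolding combination_fps_times_Q[OF \<nu> Q]
      using \<nu> by (simp add: eval_fps_mult eval_fps_diff radius_mult radius_diff j_one(1))
    finally show ?thesis .
  qed
  have e1: "of_real ?Q * eval_fps (fps_deriv ?G) 1 = of_real (- a * j_one \<nu> - (?Q - a) / (4 * (\<nu> + 1)) * j_one (\<nu> + 1)
      - (b - a) / (2 * (\<nu> + 1)) * (j_one (\<nu> + 1) - 1 / (4 * (\<nu> + 2)) * j_one (\<nu> + 2)))"
  proof -
    have "of_real ?Q * eval_fps (fps_deriv ?G) 1 = eval_fps (fps_deriv (fps_const (of_real ?Q) * ?G)) 1"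
      using \<nu> by (simp add: eval_fps_mult radius_deriv)
    also have "fps_deriv (fps_const (of_real ?Q) * ?G)
      = (fps_const (of_real ?Q) - fps_const (of_real a) * fps_X) * fps_deriv (j_fps \<nu>)
        - fps_const (of_real a) * j_fps \<nu>
       - fps_const (of_real ((b - a) / (2 * (\<nu> + 1)))) * (fps_X * fps_deriv (j_fps (\<nu> + 1)) + j_fps (\<nu> + 1))"
      unfolding combination_fps_times_Q[OF \<nu> Q] by (simp add: algebra_simps)
    also have "eval_fps \<dots> 1 = of_real (- a * j_one \<nu> - (?Q - a) / (4 * (\<nu> + 1)) * j_one (\<nu> + 1)
      - (b - a) / (2 * (\<nu> + 1)) * (j_one (\<nu> + 1) - 1 / (4 * (\<nu> + 2)) * j_one (\<nu> + 2)))"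
      using \<nu> fps_deriv_j_fps[OF \<nu>] fps_deriv_j_fps[of "\<nu> + 1"]
      by (simp add: eval_fps_mult eval_fps_diff eval_fps_add eval_fps_minus radius_mult radius_diff radius_add
          j_one(1) add.assoc)
    finally show ?thesis .
  qed
  have "of_real (2 * ?Q) * (eval_fps ?G 1 + eval_fps (fps_deriv ?G) 1)
      = complex_of_real (2 * (((?Q - a) * j_one \<nu> - (b - a) / (2 * (\<nu> + 1)) * j_one (\<nu> + 1))
       + (- a * j_one \<nu> - (?Q - a) / (4 * (\<nu> + 1)) * j_one (\<nu> + 1)
      - (b - a) / (2 * (\<nu> + 1)) * (j_one (\<nu> + 1) - 1 / (4 * (\<nu> + 2)) * j_one (\<nu> + 2)))))"
    using arg_cong2[OF e0 e1, of "\<lambda>x y. 2 * (x + y)"] by (simp only: of_real_add of_real_mult of_real_numeral distrib_left mult.assoc)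
  also have "2 * (((?Q - a) * j_one \<nu> - (b - a) / (2 * (\<nu> + 1)) * j_one (\<nu> + 1))
       + (- a * j_one \<nu> - (?Q - a) / (4 * (\<nu> + 1)) * j_one (\<nu> + 1)
      - (b - a) / (2 * (\<nu> + 1)) * (j_one (\<nu> + 1) - 1 / (4 * (\<nu> + 2)) * j_one (\<nu> + 2))))
     = (2 - ?q) * threshold_fun a b c bessel_ratio \<nu> * j_one \<nu>"
  proof -
    have "1 / (4 * (\<nu> + 2)) * j_one (\<nu> + 2) = (\<nu> + 1) * (1 / (4 * (\<nu> + 1) * (\<nu> + 2)) * j_one (\<nu> + 2))"
      using \<nu> by (simp add: divide_simps) (simp add: algebra_simps)
    also have "\<dots> = (\<nu> + 1) * (2 * (\<nu> + 1) * ?q - 1) * j_one \<nu>"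
      unfolding j2 j1 by (simp add: algebra_simps)
    finally have j2': "1 / (4 * (\<nu> + 2)) * j_one (\<nu> + 2) = (\<nu> + 1) * (2 * (\<nu> + 1) * ?q - 1) * j_one \<nu>" .
    have n1: "\<nu> + 1 \<noteq> 0" using \<nu> by simp
    have t1: "(b - a) / (2 * (\<nu> + 1)) * j_one (\<nu> + 1) = (b - a) * ?q * j_one \<nu>"
      unfolding j1 using n1 by simp
    have t2: "(?Q - a) / (4 * (\<nu> + 1)) * j_one (\<nu> + 1) = (?Q - a) * ?q / 2 * j_one \<nu>"
      unfolding j1 using n1 by (simp add: divide_simps)
    have "(b - a) / (2 * (\<nu> + 1)) * ((\<nu> + 1) * (2 * (\<nu> + 1) * ?q - 1) * j_one \<nu>)
        = (b - a) / 2 * (2 * (\<nu> + 1) * ?q - 1) * j_one \<nu>"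
      using n1 by (simp add: divide_simps)
    hence t3: "(b - a) / (2 * (\<nu> + 1)) * (j_one (\<nu> + 1) - 1 / (4 * (\<nu> + 2)) * j_one (\<nu> + 2))
        = (b - a) * ?q * j_one \<nu> - (b - a) / 2 * (2 * (\<nu> + 1) * ?q - 1) * j_one \<nu>"
      unfolding j2' right_diff_distrib[of "(b - a) / (2 * (\<nu> + 1))"] t1 by simp
    have n: "?q \<noteq> 2" using q_le[OF \<nu>] by auto
    show ?thesis unfolding t1 t2 t3 threshold_fun_eq[of bessel_ratio \<nu>, OF n]
      by (simp add: Q_poly_def field_simps power2_eq_square)
  qed
  finally have "of_real (2 * ?Q) * (eval_fps ?G 1 + eval_fps (fps_deriv ?G) 1)
      = complex_of_real ((2 - ?q) * threshold_fun a b c bessel_ratio \<nu> * j_one \<nu>)" .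
  thus ?thesis using Q by (simp add: field_simps)
qed

section \<open>The admissible parameters\<close>

lemma Q_poly_eq_poly: "Q_poly a b c x = poly [:c, b - a, a:] x"
  by (simp add: Q_poly_def algebra_simps)

lemma root_le_nu_bar:
  assumes "b \<noteq> a" "Q_poly a b c x = 0"
  shows "x \<le> nu_bar a b c"
proof -
  have "finite {x. Q_poly a b c x = 0}"
    unfolding Q_poly_eq_poly using assms by (intro poly_roots_finite) auto
  hence "x \<le> Max {x. Q_poly a b c x = 0}" using assms by (intro Max_ge) auto
  thus ?thesis using assms by (auto simp: nu_bar_def)
qed

lemma nu_bar_nonneg: "nu_bar a b c \<ge> 0"
  by (simp add: nu_bar_def)

text \<open>
  If \<open>a < 0\<close> and \<open>c \<ge> 0\<close>, the discriminant of \<open>Q\<close> is nonnegative and \<open>Q\<close> is not positive beyond its largest root.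
\<close>

lemma leading_coeff_nonneg:
  assumes "c \<ge> 0" "b \<noteq> a" "\<nu> \<ge> nu_bar a b c" "Q_poly a b c \<nu> > 0"
  shows "a \<ge> 0"
proof (rule ccontr)
  assume "\<not> a \<ge> 0"
  hence a: "a < 0" by simp
  define S where "S = sqrt ((b - a)\<^sup>2 - 4 * a * c)"
  have "a * c \<le> 0" using a assms by (simp add: mult_nonpos_nonneg)
  hence "4 * a * c \<le> 0" by (simp add: mult.assoc)
  hence "0 \<le> (b - a)\<^sup>2 - 4 * a * c" using zero_le_power2[of "b - a"] by linarith
  hence S: "S\<^sup>2 = (b - a)\<^sup>2 - 4 * a * c" "S \<ge> 0" by (simp_all add: S_def)
  define r r' where "r = ((b - a) + S) / (- 2 * a)" and "r' = ((b - a) - S) / (- 2 * a)"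
  have rr: "a * (r + r') = - (b - a)" "a * (r * r') = c"
  proof -
    show "a * (r + r') = - (b - a)" using a by (simp add: r_def r'_def field_simps)
    have "r * r' = ((b - a)\<^sup>2 - S\<^sup>2) / (4 * a\<^sup>2)"
      by (simp add: r_def r'_def power2_eq_square algebra_simps)
    also have "(b - a)\<^sup>2 - S\<^sup>2 = 4 * a * c" using S(1) by simp
    finally show "a * (r * r') = c" using a by (simp add: power2_eq_square)
  qed
  have Q: "Q_poly a b c x = a * ((x - r) * (x - r'))" for x
  proof -
    have "a * ((x - r) * (x - r')) = a * x\<^sup>2 - a * (r + r') * x + a * (r * r')"
      by (simp add: algebra_simps power2_eq_square)
    thus ?thesis unfolding rr by (simp add: Q_poly_def algebra_simps power2_eq_square)
  qed
  have "r \<le> \<nu>" using root_le_nu_bar[of b a c r] assms Q[of r] by simp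
  moreover have "r' \<le> r" using a S(2) by (simp add: r_def r'_def divide_simps)
  ultimately have "0 \<le> (\<nu> - r) * (\<nu> - r')" by (intro mult_nonneg_nonneg) auto
  hence "Q_poly a b c \<nu> \<le> 0" unfolding Q using a by (simp add: mult_nonpos_nonneg)
  thus False using assms by simp
qed

lemma parameter_cases:
  assumes ab: "(c = 0 \<and> b \<noteq> a) \<or> (c > 0 \<and> b > a)"
    and \<nu>: "\<nu> \<ge> nu_bar a b c" and Q: "Q_poly a b c \<nu> > 0"
  obtains (nonneg_coeffs) "0 \<le> a" "a < b" "0 \<le> c" "nu_bar a b c = 0"
  | (two_roots) s where "0 < a" "b = a * (1 - s)" "c = 0" "0 < s" "nu_bar a b c = s"
proof -
  have a: "a \<ge> 0" using leading_coeff_nonneg[of c b a \<nu>] assms by auto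
  show thesis
  proof (cases "a < b")
    case True
    have "Q_poly a b c x > 0" if "x > 0" for x
    proof -
      have "Q_poly a b c x = a * x\<^sup>2 + (b - a) * x + c"
        by (simp add: Q_poly_def algebra_simps power2_eq_square)
      moreover have "(b - a) * x > 0" "a * x\<^sup>2 \<ge> 0" "c \<ge> 0" using True that a ab by auto
      ultimately show ?thesis by linarith
    qed
    hence le: "{x. Q_poly a b c x = 0} \<subseteq> {..0}" by (force simp: not_less[symmetric])
    have fin: "finite {x. Q_poly a b c x = 0}"
      unfolding Q_poly_eq_poly using True by (intro poly_roots_finite) auto
    have "nu_bar a b c = 0"
    proof (cases "\<exists>x. Q_poly a b c x = 0")
      case True
      hence "Max {x. Q_poly a b c x = 0} \<in> {x. Q_poly a b c x = 0}"
        using fin by (intro Max_in) auto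
      thus ?thesis using le by (auto simp: nu_bar_def)
    qed (simp add: nu_bar_def)
    thus ?thesis using nonneg_coeffs True a ab by auto
  next
    case False
    hence c: "c = 0" and b: "b < a" using ab by auto
    have "a > 0"
    proof (rule ccontr)
      assume "\<not> a > 0"
      hence "a = 0" using a by simp
      moreover have "b * \<nu> \<le> 0"
        using b \<open>a = 0\<close> \<nu> nu_bar_nonneg[of a b c] by (intro mult_nonpos_nonneg) auto
      ultimately show False using Q c by (simp add: Q_poly_def)
    qed
    define s where "s = 1 - b / a"
    have s: "b = a * (1 - s)" "0 < s" using \<open>a > 0\<close> b by (auto simp: s_def field_simps)
    have "Q_poly a b c x = a * (x * (x - s))" for x
      unfolding Q_poly_def c s(1) by (simp add: algebra_simps)
    hence "{x. Q_poly a b c x = 0} = {0, s}" using \<open>a > 0\<close> by auto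
    hence "nu_bar a b c = s" using s by (auto simp: nu_bar_def)
    thus ?thesis using two_roots[of s] \<open>a > 0\<close> s c by blast
  qed
qed

text \<open>
  These are the two shapes of \<open>Q\<close> that the hypotheses of the theorem allow, together with \<open>Q(\<nu>) > 0\<close>; this is
  what the analytic part of the proof works with.
\<close>

definition admissible :: "real \<Rightarrow> real \<Rightarrow> real \<Rightarrow> real \<Rightarrow> bool" where
  "admissible a b c \<nu> \<longleftrightarrow> 0 \<le> \<nu> \<and> 0 < Q_poly a b c \<nu> \<and>
     (0 \<le> a \<and> a < b \<and> 0 \<le> c \<or> (\<exists>s. 0 < a \<and> b = a * (1 - s) \<and> c = 0 \<and> 0 < s \<and> s < \<nu>))"

lemma admissibleI:
  assumes "(c = 0 \<and> b \<noteq> a) \<or> (c > 0 \<and> b > a)"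
    and \<nu>: "\<nu> \<ge> nu_bar a b c" and Q: "Q_poly a b c \<nu> > 0"
  shows "admissible a b c \<nu>"
  using assms
proof (cases rule: parameter_cases)
  case nonneg_coeffs
  thus ?thesis using Q \<nu> by (auto simp: admissible_def)
next
  case (two_roots s)
  have "\<nu> \<noteq> s" using Q two_roots by (auto simp: Q_poly_def algebra_simps)
  thus ?thesis using two_roots Q \<nu> by (auto simp: admissible_def intro!: exI[of _ s])
qed

text \<open>
  With \<open>x = 2 n + \<nu>\<close>, each linear factor grows by at most \<open>(x + 2) / x \<le> (n + 1) / n\<close>, also
  after subtracting a root \<open>s \<le> \<nu>\<close> from \<open>x\<close>.
\<close>

lemma Q_poly_growth:
  assumes "admissible a b c \<nu>"
  shows "Q_poly a b c (2 * real n + \<nu>) > 0"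
    and "Q_poly a b c (2 * real (Suc n) + \<nu>) * (real n)\<^sup>2 \<le> Q_poly a b c (2 * real n + \<nu>) * (real (Suc n))\<^sup>2"
proof -
  define x where "x = 2 * real n + \<nu>"
  have nu: "0 \<le> \<nu>" using assms by (simp add: admissible_def)
  have x: "0 \<le> x" "2 * real (Suc n) + \<nu> = x + 2" using nu by (auto simp: x_def)
  have 1: "(x + 2) * real n \<le> x * real (Suc n)" using nu by (simp add: x_def algebra_simps)
  from assms consider "0 \<le> a" "a < b" "0 \<le> c" | s where "0 < a" "b = a * (1 - s)" "c = 0" "0 < s" "s < \<nu>"
    by (auto simp: admissible_def)
  hence "Q_poly a b c x > 0 \<and> Q_poly a b c (x + 2) * (real n)\<^sup>2 \<le> Q_poly a b c x * (real (Suc n))\<^sup>2"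
  proof cases
    case 1
    have Q: "Q_poly a b c y = a * y\<^sup>2 + (b - a) * y + c" for y
      by (simp add: Q_poly_def algebra_simps power2_eq_square)
    have q0: "0 < Q_poly a b c \<nu>" using assms by (simp add: admissible_def)
    have "a * \<nu>\<^sup>2 \<le> a * x\<^sup>2" "(b - a) * \<nu> \<le> (b - a) * x"
      using 1 nu by (auto intro!: mult_left_mono power_mono simp: x_def)
    hence "Q_poly a b c \<nu> \<le> Q_poly a b c x" unfolding Q by linarith
    hence pos: "Q_poly a b c x > 0" using q0 by linarith
    have "((x + 2) * real n)\<^sup>2 \<le> (x * real (Suc n))\<^sup>2"
      using \<open>(x + 2) * real n \<le> _\<close> x by (intro power_mono) auto
    hence "a * ((x + 2) * real n)\<^sup>2 \<le> a * (x * real (Suc n))\<^sup>2" using 1 by (intro mult_left_mono)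
    moreover have "(x + 2) * real n * real n \<le> x * real (Suc n) * real (Suc n)"
      using x by (intro mult_mono[OF \<open>(x + 2) * real n \<le> _\<close>]) auto
    hence "(b - a) * ((x + 2) * real n * real n) \<le> (b - a) * (x * real (Suc n) * real (Suc n))"
      using 1 by (intro mult_left_mono) auto
    moreover have "c * (real n)\<^sup>2 \<le> c * (real (Suc n))\<^sup>2"
      using 1 by (intro mult_left_mono power_mono) auto
    moreover have "Q_poly a b c y * m\<^sup>2 = a * (y * m)\<^sup>2 + (b - a) * (y * m * m) + c * m\<^sup>2" for y m
      unfolding Q by (simp add: algebra_simps power2_eq_square)
    ultimately have "Q_poly a b c (x + 2) * (real n)\<^sup>2 \<le> Q_poly a b c x * (real (Suc n))\<^sup>2"
      by (metis add_mono)
    thus ?thesis using pos by blast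
  next
    case (2 s)
    have Q: "Q_poly a b c y = a * (y * (y - s))" for y
      unfolding Q_poly_def 2(2,3) by (simp add: algebra_simps)
    have xs: "0 < x - s" "0 < x" using 2 nu by (auto simp: x_def)
    have shifted: "(x + 2 - s) * real n \<le> (x - s) * real (Suc n)" using 2 by (simp add: x_def algebra_simps)
    have "((x + 2) * real n) * ((x + 2 - s) * real n) \<le> (x * real (Suc n)) * ((x - s) * real (Suc n))"
      by (rule mult_mono[OF \<open>(x + 2) * real n \<le> _\<close> shifted]) (use xs in auto)
    hence "a * (((x + 2) * real n) * ((x + 2 - s) * real n)) \<le> a * ((x * real (Suc n)) * ((x - s) * real (Suc n)))"
      using 2 by (intro mult_left_mono) auto
    thus ?thesis unfolding Q using xs 2 by (simp add: algebra_simps power2_eq_square)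
  qed
  thus "Q_poly a b c (2 * real n + \<nu>) > 0"
    "Q_poly a b c (2 * real (Suc n) + \<nu>) * (real n)\<^sup>2 \<le> Q_poly a b c (2 * real n + \<nu>) * (real (Suc n))\<^sup>2"
    unfolding x(2) by (simp_all add: x_def)
qed

lemma combination_coeff_pos: "admissible a b c \<nu> \<Longrightarrow> combination_coeff a b c \<nu> n > 0"
  using Q_poly_growth(1)[of a b c \<nu> n] j_coeff_pos[of \<nu> n] by (auto simp: combination_coeff_def admissible_def)

lemma combination_coeff_0: "admissible a b c \<nu> \<Longrightarrow> combination_coeff a b c \<nu> 0 = 1"
  by (simp add: combination_coeff_def admissible_def j_coeff_def)

text \<open>
  The factor \<open>((n + 1) / n)\<^sup>2\<close> by which \<open>Q\<close> can grow is absorbed by the decay of the Bessel coefficients,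
  which is at least \<open>4 (n + 1)\<^sup>2\<close>.
\<close>

lemma combination_coeff_Suc_le:
  assumes adm: "admissible a b c \<nu>"
  shows "4 * (real n)\<^sup>2 * combination_coeff a b c \<nu> (Suc n) \<le> combination_coeff a b c \<nu> n"
proof -
  have nu: "0 \<le> \<nu>" and Q: "0 < Q_poly a b c \<nu>" using adm by (simp_all add: admissible_def)
  let ?Q = "\<lambda>n. Q_poly a b c (2 * real n + \<nu>)"
  have j: "4 * (real (Suc n))\<^sup>2 * j_coeff \<nu> (Suc n) \<le> j_coeff \<nu> n"
  proof -
    have "real (Suc n) * real (Suc n) \<le> real (Suc n) * (\<nu> + real (Suc n))"
      using nu by (intro mult_left_mono) auto
    hence "real (Suc n) * real (Suc n) * (4 * j_coeff \<nu> (Suc n)) \<le> real (Suc n) * (\<nu> + real (Suc n)) * (4 * j_coeff \<nu> (Suc n))"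
      using j_coeff_pos[OF nu, of "Suc n"] by (intro mult_right_mono) auto
    also have "\<dots> = j_coeff \<nu> n" using j_coeff_Suc[OF nu, of n] by (simp only: mult_ac)
    finally show ?thesis by (simp only: power2_eq_square mult_ac)
  qed
  have "?Q (Suc n) * (real n)\<^sup>2 * (4 * j_coeff \<nu> (Suc n)) \<le> ?Q n * (real (Suc n))\<^sup>2 * (4 * j_coeff \<nu> (Suc n))"
    using Q_poly_growth(2)[OF adm, of n] j_coeff_pos[OF nu, of "Suc n"] by (intro mult_right_mono) auto
  also have "\<dots> = ?Q n * (4 * (real (Suc n))\<^sup>2 * j_coeff \<nu> (Suc n))" by (simp only: mult_ac)
  also have "\<dots> \<le> ?Q n * j_coeff \<nu> n"
    using j Q_poly_growth(1)[OF adm, of n] by (intro mult_left_mono) auto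
  finally have "?Q (Suc n) * (real n)\<^sup>2 * (4 * j_coeff \<nu> (Suc n)) / Q_poly a b c \<nu> \<le> ?Q n * j_coeff \<nu> n / Q_poly a b c \<nu>"
    using Q by (intro divide_right_mono) auto
  thus ?thesis by (simp add: combination_coeff_def mult_ac)
qed

text \<open>
  In both cases the combination is built from the Bessel series by operations that preserve nonnegativity.  If
  the coefficients of \<open>Q\<close> are nonnegative, the combination is the Bessel series times \<open>1 - H\<close>, where \<open>H\<close> is a
  nonnegative combination of \<open>z\<close> and of \<open>z\<close> times the quotient of two consecutive Bessel series; here \<open>Q\<close> may
  well have no real roots.  If \<open>Q(\<mu>) = a \<mu> (\<mu> - s)\<close>, the quotient \<open>Q(2 n + \<nu>) / Q(\<nu>)\<close> is a product of two factors
  \<open>1 + n / \<alpha>\<close> with \<open>\<alpha> > 0\<close>.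
\<close>

lemma log_decay_combination_fps:
  assumes adm: "admissible a b c \<nu>"
  shows "nonneg_fps (log_decay (combination_fps a b c \<nu>))"
proof -
  let ?Q = "Q_poly a b c \<nu>"
  have nu: "0 \<le> \<nu>" and Q: "0 < ?Q" using adm by (simp_all add: admissible_def)
  from adm consider "0 \<le> a" "a < b" "0 \<le> c" | s where "0 < a" "b = a * (1 - s)" "c = 0" "0 < s" "s < \<nu>"
    by (auto simp: admissible_def)
  thus ?thesis
  proof cases
    case 1
    define p where "p = j_fps (\<nu> + 1) * inverse (j_fps \<nu>)"
    have jp: "j_fps (\<nu> + 1) = j_fps \<nu> * p"
    proof -
      have "j_fps \<nu> * inverse (j_fps \<nu>) = 1" by (rule inverse_mult_eq_1') simp
      hence "j_fps (\<nu> + 1) = j_fps (\<nu> + 1) * (j_fps \<nu> * inverse (j_fps \<nu>))" by simp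
      thus ?thesis by (simp only: p_def mult_ac)
    qed
    define \<alpha> \<beta> where "\<alpha> = a / ?Q" and "\<beta> = (b - a) / (2 * (\<nu> + 1)) / ?Q"
    define H where "H = fps_const (of_real \<alpha>) * fps_X + fps_const (of_real \<beta>) * (fps_X * p)"
    have c1: "fps_const (complex_of_real ?Q) * fps_const (of_real \<alpha>) = fps_const (of_real a)"
      using Q by (simp add: \<alpha>_def)
    have c2: "fps_const (complex_of_real ?Q) * fps_const (of_real \<beta>) = fps_const (of_real ((b - a) / (2 * (\<nu> + 1))))"
      using Q by (simp add: \<beta>_def del: of_real_divide flip: of_real_mult)
    have "fps_const (of_real ?Q) * (j_fps \<nu> * (1 - H))
      = (fps_const (of_real ?Q) - fps_const (of_real ?Q) * fps_const (of_real \<alpha>) * fps_X) * j_fps \<nu>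
        - fps_const (of_real ?Q) * fps_const (of_real \<beta>) * (fps_X * (j_fps \<nu> * p))"
      unfolding H_def by (simp only: algebra_simps mult_1_left)
    also have "\<dots> = fps_const (of_real ?Q) * combination_fps a b c \<nu>"
      unfolding c1 c2 jp[symmetric] using combination_fps_times_Q[OF nu, of a b c] Q by simp
    finally have "combination_fps a b c \<nu> = j_fps \<nu> * (1 - H)"
      using Q by simp
    moreover have "nonneg_fps H"
    proof -
      have "0 \<le> \<alpha>" "0 \<le> \<beta>" using 1 Q nu by (auto simp: \<alpha>_def \<beta>_def)
      thus ?thesis unfolding H_def p_def
        by (intro nonneg_fps_add nonneg_fps_mult[OF nonneg_fps_const] nonneg_fps_mult[OF nonneg_fps_X]
              nonneg_fps_X j_fps_quotient_nonneg nu)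
    qed
    ultimately show ?thesis
      using log_decay_mult_one_minus[OF _ log_decay_j_fps[OF nu], of H] by (simp add: H_def)
  next
    case (2 s)
    define F where "F = Abs_fps (\<lambda>n. of_real (1 + real n / (\<nu> / 2)) * fps_nth (j_fps \<nu>) n)"
    have F: "nonneg_fps (log_decay F)"
      by (rule log_decay_euler_step[of "j_fps \<nu>" "\<nu> / 2"])
         (use 2 in \<open>auto simp: F_def intro!: log_decay_j_fps\<close>)
    show ?thesis
    proof (rule log_decay_euler_step[OF _ F, of "(\<nu> - s) / 2"])
      show "fps_nth F 0 = 1" by (simp add: F_def)
      show "(\<nu> - s) / 2 > 0" using 2 by simp
      fix n
      have "Q_poly a b c y = a * (y * (y - s))" for y
        unfolding Q_poly_def 2(2,3) by (simp add: algebra_simps)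
      note Q_eq = this
      have "Q_poly a b c (2 * real n + \<nu>) / ?Q = (1 + real n / ((\<nu> - s) / 2)) * (1 + real n / (\<nu> / 2))"
        unfolding Q_eq using 2 by (simp add: divide_simps) (simp add: algebra_simps)
      thus "fps_nth (combination_fps a b c \<nu>) n = of_real (1 + real n / ((\<nu> - s) / 2)) * fps_nth F n"
        unfolding combination_fps_def combination_coeff_def alt_fps_def F_def j_fps_def fps_nth_Abs_fps by (simp only: of_real_mult mult_ac)
    qed
  qed
qed

text \<open>
  The coefficients decrease in absolute value: the first step is the assumption, the later ones hold for all
  admissible parameters.
\<close>

lemma combination_fps_positive:
  assumes adm: "admissible a b c \<nu>" and c1: "combination_coeff a b c \<nu> 1 < 1" and r: "0 \<le> r" "r \<le> 1"
  obtains y where "eval_fps (combination_fps a b c \<nu>) (of_real r) = of_real y" "y > 0"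
proof -
  have nu: "0 \<le> \<nu>" using adm by (simp add: admissible_def)
  have dec: "combination_coeff a b c \<nu> (Suc n) \<le> combination_coeff a b c \<nu> n" for n
  proof (cases n)
    case 0
    thus ?thesis using c1 combination_coeff_0[OF adm] by simp
  next
    case (Suc m)
    have "1 \<le> (real n)\<^sup>2" using Suc by (intro one_le_power) simp
    hence "1 * combination_coeff a b c \<nu> (Suc n) \<le> 4 * (real n)\<^sup>2 * combination_coeff a b c \<nu> (Suc n)"
      using combination_coeff_pos[OF adm, of "Suc n"] by (intro mult_right_mono) auto
    thus ?thesis using combination_coeff_Suc_le[OF adm, of n] by linarith
  qed
  show thesis
    by (rule eval_alt_fps_bounds[of "combination_coeff a b c \<nu>" r])
       (use nu c1 combination_coeff_0[OF adm] combination_coeff_pos[OF adm] dec r that in \<open>auto simp flip: combination_fps_def\<close>)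
qed

section \<open>Starlikeness and the derivatives of the Bessel combination\<close>

lemma starlike_bessel_combination_if:
  assumes adm: "admissible a b c \<nu>" and c1: "combination_coeff a b c \<nu> 1 < 1"
    and t: "eval_fps (combination_fps a b c \<nu>) 1 + eval_fps (fps_deriv (combination_fps a b c \<nu>)) 1 = of_real t" "0 \<le> t"
  shows "starlike_in_disk (bessel_combination a b c \<nu>)"
proof -
  let ?G = "combination_fps a b c \<nu>"
  have nu: "0 \<le> \<nu>" using adm by (simp add: admissible_def)
  have nz: "eval_fps ?G (of_real r) \<noteq> 0" if "0 \<le> r" "r \<le> 1" for r
    using combination_fps_positive[OF adm c1 that] by (metis of_real_eq_0_iff less_irrefl)
  obtain y where y: "eval_fps ?G 1 = of_real y" "y > 0"
    using combination_fps_positive[OF adm c1, of 1] by auto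
  have "- eval_fps (fps_deriv ?G) 1 = of_real (y - t)" using t y by (simp add: algebra_simps)
  hence "Re (- eval_fps (fps_deriv ?G) 1 / eval_fps ?G 1) = (y - t) / y"
    unfolding y(1) by (simp flip: of_real_divide)
  hence one: "Re (- eval_fps (fps_deriv ?G) 1 / eval_fps ?G 1) \<le> 1" using y t by simp
  have G0: "fps_nth ?G 0 = 1" using combination_coeff_0[OF adm] by (simp add: combination_fps_def alt_fps_def)
  note b = log_decay_bound_in_disk[OF radius_combination_fps[OF nu] G0 log_decay_combination_fps[OF adm] nz one]
  have d: "deriv (eval_fps ?G) z = eval_fps (fps_deriv ?G) z" for z
    using nu by (intro DERIV_imp_deriv has_field_derivative_eval_fps) simp
  have "starlike_in_disk (\<lambda>z. z * eval_fps ?G z)"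
  proof (rule starlike_in_disk_if_Re_pos)
    show "eval_fps ?G holomorphic_on ball 0 1" using nu by (intro holomorphic_on_eval_fps) simp
    fix z :: complex assume z: "z \<in> ball 0 1"
    show "eval_fps ?G z \<noteq> 0" by (rule b(1)[OF _ _ z])
    have "norm (z * (eval_fps (fps_deriv ?G) z / eval_fps ?G z)) \<le> norm z * 1"
      unfolding norm_mult by (intro mult_left_mono b(2)[OF _ _ z]) auto
    hence "norm (z * deriv (eval_fps ?G) z / eval_fps ?G z) < 1" using z by (simp add: d)
    thus "0 < Re (1 + z * deriv (eval_fps ?G) z / eval_fps ?G z)"
      using abs_Re_le_cmod[of "z * deriv (eval_fps ?G) z / eval_fps ?G z"] by simp
  qed
  also have "(\<lambda>z. z * eval_fps ?G z) = bessel_combination a b c \<nu>"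
    using bessel_combination_eq(1)[OF nu] by auto
  finally show ?thesis .
qed

text \<open>
  Otherwise the derivative of the combination, which is real on the real axis and 1 at the origin, has a zero in
  \<open>(0,1)\<close>, where an injective holomorphic function has none.
\<close>

lemma nonneg_if_starlike_bessel_combination:
  assumes adm: "admissible a b c \<nu>"
    and t: "eval_fps (combination_fps a b c \<nu>) 1 + eval_fps (fps_deriv (combination_fps a b c \<nu>)) 1 = of_real t"
    and star: "starlike_in_disk (bessel_combination a b c \<nu>)"
  shows "0 \<le> t"
proof (rule ccontr)
  assume neg: "\<not> 0 \<le> t"
  let ?G = "combination_fps a b c \<nu>"
  define F where "F = fps_X * ?G"
  define h where "h = (\<lambda>r. Re (eval_fps (fps_deriv F) (of_real r)))"
  have nu: "0 \<le> \<nu>" using adm by (simp add: admissible_def)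
  have rad: "fps_conv_radius F = \<infinity>" "fps_conv_radius (fps_deriv F) = \<infinity>"
    using nu by (auto simp: F_def intro!: radius_mult radius_add radius_deriv)
  have D: "deriv (eval_fps F) z = eval_fps (fps_deriv F) z" for z
    using rad by (intro DERIV_imp_deriv has_field_derivative_eval_fps) simp
  have "fps_deriv F = ?G + fps_X * fps_deriv ?G" by (simp add: F_def)
  hence "eval_fps (fps_deriv F) 1 = of_real t"
    using t nu by (simp add: eval_fps_add eval_fps_mult radius_mult radius_deriv)
  hence h1: "h 1 < 0" using neg by (simp add: h_def)
  have "fps_nth ?G 0 = 1" using combination_coeff_0[OF adm] by (simp add: combination_fps_def alt_fps_def)
  hence h0: "h 0 = 1" by (simp add: h_def eval_fps_at_0 F_def)
  have "continuous_on {0..1} h"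
    unfolding h_def using rad by (intro continuous_intros) auto
  then obtain r where r: "0 \<le> r" "r \<le> 1" "h r = 0"
    using IVT2'[of h 1 0 0] h0 h1 by auto
  have "r \<noteq> 1" using r h1 by auto
  have real: "Im (eval_fps (fps_deriv F) (of_real r)) = 0"
  proof -
    have "fps_nth (fps_deriv F) n = of_real (Re (fps_nth (fps_deriv F) n))" for n
      by (simp add: F_def combination_fps_def alt_fps_def complex_eq_iff)
    hence "(\<lambda>n. Im (fps_nth (fps_deriv F) n * of_real r ^ n)) = (\<lambda>_. 0)"
      by (metis Im_complex_of_real of_real_mult of_real_power)
    moreover have "(\<lambda>n. Im (fps_nth (fps_deriv F) n * of_real r ^ n)) sums Im (eval_fps (fps_deriv F) (of_real r))"
      using rad by (intro sums_Im sums_eval_fps) simp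
    ultimately show ?thesis using sums_unique2[OF sums_zero] by metis
  qed
  have "deriv (eval_fps F) (of_real r) = 0"
    using r(3) real unfolding D h_def by (simp add: complex_eq_iff)
  moreover have "deriv (eval_fps F) (of_real r) \<noteq> 0"
    using star unfolding starlike_in_disk_def bessel_combination_eq(2)[OF nu] F_def[symmetric]
    using r \<open>r \<noteq> 1\<close> by (intro holomorphic_injective_imp_regular[of _ "ball 0 1"]) auto
  ultimately show False by contradiction
qed

lemma fps_nth_iterated_deriv:
  "fps_nth ((fps_deriv ^^ k) F) n = pochhammer (of_nat (n + 1)) k * fps_nth F (n + k)" for F :: "complex fps"
proof (induction k arbitrary: n)
  case (Suc k)
  have "fps_nth ((fps_deriv ^^ Suc k) F) n = of_nat (n + 1) * fps_nth ((fps_deriv ^^ k) F) (n + 1)"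
    by simp
  thus ?case unfolding Suc.IH using pochhammer_rec[of "of_nat (n + 1) :: complex" k]
    by (simp add: add_ac mult_ac)
qed simp

lemma iterated_deriv_eval_fps:
  fixes F :: "complex fps"
  assumes "fps_conv_radius F = \<infinity>"
  shows "(deriv ^^ k) (eval_fps F) = eval_fps ((fps_deriv ^^ k) F)" "fps_conv_radius ((fps_deriv ^^ k) F) = \<infinity>"
proof -
  have r: "fps_conv_radius ((fps_deriv ^^ k) F) = \<infinity>" for k
    by (induction k) (auto simp: assms radius_deriv)
  show "(deriv ^^ k) (eval_fps F) = eval_fps ((fps_deriv ^^ k) F)"
  proof (induction k)
    case (Suc k)
    have "deriv (eval_fps ((fps_deriv ^^ k) F)) z = eval_fps (fps_deriv ((fps_deriv ^^ k) F)) z" for z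
      using r[of k] by (intro DERIV_imp_deriv has_field_derivative_eval_fps) simp
    thus ?case using Suc by auto
  qed simp
  show "fps_conv_radius ((fps_deriv ^^ k) F) = \<infinity>" by (rule r)
qed

text \<open>
  The \<open>m\<close>-th coefficient of the derivative of order \<open>k + 1\<close> is that of index \<open>N = m + k\<close> of \<open>f(z) / z\<close>, times a
  Pochhammer symbol.  The quotient of two consecutive ones is at most
  \<open>(N + 2) / (4 N\<^sup>2 (m + 1))\<close>, which is at most 3/4 for \<open>m = 0\<close> and at most 1/4 for \<open>m \<ge> 1\<close>, since \<open>N > m\<close>.
\<close>

lemma derivatives_close_to_convex:
  assumes adm: "admissible a b c \<nu>" and k: "k \<ge> 1"
  shows "close_to_convex_in_disk ((deriv ^^ k) (bessel_combination a b c \<nu>))"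
    "inj_on ((deriv ^^ k) (bessel_combination a b c \<nu>)) (ball 0 1)"
proof -
  define F where "F = fps_X * combination_fps a b c \<nu>"
  define D where "D = (fps_deriv ^^ Suc k) F"
  let ?h = "(deriv ^^ k) (bessel_combination a b c \<nu>)"
  have nu: "0 \<le> \<nu>" using adm by (simp add: admissible_def)
  have rad: "fps_conv_radius F = \<infinity>" using nu by (auto simp: F_def intro!: radius_mult)
  have h: "?h = eval_fps ((fps_deriv ^^ k) F)"
    unfolding bessel_combination_eq(2)[OF nu] F_def[symmetric] by (rule iterated_deriv_eval_fps(1)[OF rad])
  have nD: "norm (fps_nth D m) = pochhammer (real (m + 1)) (Suc k) * combination_coeff a b c \<nu> (m + k)" for m
  proof -
    have "fps_nth D m = of_real (pochhammer (real (m + 1)) (Suc k)) * ((-1) ^ (m + k) * of_real (combination_coeff a b c \<nu> (m + k)))"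
      unfolding D_def fps_nth_iterated_deriv by (simp add: F_def combination_fps_def alt_fps_def pochhammer_of_real[symmetric] del: of_nat_add)
    thus ?thesis
      using combination_coeff_pos[OF adm, of "m + k"]
      by (simp add: norm_mult norm_power pochhammer_nonneg less_imp_le)
  qed
  have ratio: "4 * (real (m + k))\<^sup>2 * real (m + 1) * norm (fps_nth D (Suc m)) \<le> real (m + k + 2) * norm (fps_nth D m)" for m
  proof -
    have p: "real (m + 1) * pochhammer (real (Suc m + 1)) (Suc k) = real (m + k + 2) * pochhammer (real (m + 1)) (Suc k)"
      using pochhammer_rec[of "real (m + 1)" "Suc k"] pochhammer_Suc[of "real (m + 1)" "Suc k"]
      by (simp add: add_ac mult_ac)
    have "4 * (real (m + k))\<^sup>2 * real (m + 1) * norm (fps_nth D (Suc m))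
      = (real (m + 1) * pochhammer (real (Suc m + 1)) (Suc k)) * (4 * (real (m + k))\<^sup>2 * combination_coeff a b c \<nu> (Suc (m + k)))"
      unfolding nD by (simp only: mult_ac add_Suc)
    also have "\<dots> = real (m + k + 2) * pochhammer (real (m + 1)) (Suc k) * (4 * (real (m + k))\<^sup>2 * combination_coeff a b c \<nu> (Suc (m + k)))"
      unfolding p ..
    also have "\<dots> \<le> real (m + k + 2) * pochhammer (real (m + 1)) (Suc k) * combination_coeff a b c \<nu> (m + k)"
      by (intro mult_left_mono combination_coeff_Suc_le adm) (auto intro!: mult_nonneg_nonneg pochhammer_nonneg)
    finally show ?thesis unfolding nD by (simp only: mult_ac)
  qed
  have radD: "fps_conv_radius D = \<infinity>" unfolding D_def by (rule iterated_deriv_eval_fps(2)[OF rad])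
  have "norm (fps_nth D 0) > 0"
    unfolding nD using combination_coeff_pos[OF adm, of "0 + k"] by (intro mult_pos_pos pochhammer_pos) auto
  hence D0: "fps_nth D 0 \<noteq> 0" by auto
  have dh: "(?h has_field_derivative eval_fps D z) (at z)" for z
    unfolding h D_def funpow.simps comp_def
    using iterated_deriv_eval_fps(2)[OF rad, of k] by (intro has_field_derivative_eval_fps) simp
  have D1: "norm (fps_nth D 1) \<le> 3 / 4 * norm (fps_nth D 0)"
  proof -
    have k1: "1 \<le> real k" using k by simp
    have "real k * 1 \<le> real k * real k" using k1 by (intro mult_left_mono) auto
    moreover have "real (0 + k + 2) = real k * 1 + 2" by simp
    ultimately have "real (0 + k + 2) \<le> 3 * (real k)\<^sup>2"
      unfolding power2_eq_square using k1 by linarith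
    hence "real (0 + k + 2) * norm (fps_nth D 0) \<le> 3 * (real k)\<^sup>2 * norm (fps_nth D 0)"
      by (intro mult_right_mono) auto
    hence "4 * (real k)\<^sup>2 * norm (fps_nth D 1) \<le> 3 * (real k)\<^sup>2 * norm (fps_nth D 0)"
      using ratio[of 0] by simp
    hence "(real k)\<^sup>2 * (4 * norm (fps_nth D 1)) \<le> (real k)\<^sup>2 * (3 * norm (fps_nth D 0))"
      by (simp only: mult_ac)
    thus ?thesis using k by (subst (asm) mult_le_cancel_left_pos) auto
  qed
  have DS: "norm (fps_nth D (Suc m)) \<le> 1 / 4 * norm (fps_nth D m)" if m: "m \<ge> 1" for m
  proof -
    define N where "N = real (m + k)"
    have N: "N \<ge> 2" using m k by (simp add: N_def)
    have "N * 2 \<le> N * N" using N by (intro mult_left_mono) auto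
    hence "real (m + k + 2) \<le> 2 * N\<^sup>2" using N by (simp add: N_def power2_eq_square)
    hence "real (m + k + 2) * norm (fps_nth D m) \<le> 2 * N\<^sup>2 * norm (fps_nth D m)"
      by (intro mult_right_mono) auto
    moreover have "4 * N\<^sup>2 * 2 * norm (fps_nth D (Suc m)) \<le> 4 * N\<^sup>2 * real (m + 1) * norm (fps_nth D (Suc m))"
      using m by (intro mult_right_mono mult_left_mono) auto
    ultimately have "4 * N\<^sup>2 * 2 * norm (fps_nth D (Suc m)) \<le> 2 * N\<^sup>2 * norm (fps_nth D m)"
      using ratio[of m] unfolding N_def by linarith
    hence "N\<^sup>2 * (8 * norm (fps_nth D (Suc m))) \<le> N\<^sup>2 * (2 * norm (fps_nth D m))" by simp
    thus ?thesis using N by (subst (asm) mult_le_cancel_left_pos) auto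
  qed
  show "close_to_convex_in_disk ?h" "inj_on ?h (ball 0 1)"
    using close_to_convex_if_derivative_dominated[OF radD D0 D1 DS dh] by auto
qed

section \<open>The threshold order\<close>

lemma threshold_root:
  assumes ab: "(c = 0 \<and> b \<noteq> a) \<or> (c > 0 \<and> b > a)"
    and \<nu>: "\<nu> \<ge> nu_bar a b c" and Q: "Q_poly a b c \<nu> > 0"
    and ex: "c > 0 \<Longrightarrow> \<exists>\<mu>>nu_bar a b c. threshold_equation a b c \<mu>"
  obtains \<rho> where "\<rho> > nu_bar a b c" "threshold_equation a b c \<rho>"
    "\<And>\<mu>. \<mu> > nu_bar a b c \<Longrightarrow> threshold_equation a b c \<mu> \<Longrightarrow> \<mu> = \<rho>"
    "\<nu> \<ge> \<rho> \<longleftrightarrow> threshold_fun a b c bessel_ratio \<nu> \<ge> 0"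
proof -
  let ?T = "threshold_fun a b c bessel_ratio"
  have eq: "threshold_equation a b c \<mu> \<longleftrightarrow> ?T \<mu> = 0" if "\<mu> \<ge> nu_bar a b c" for \<mu>
    using that nu_bar_nonneg[of a b c] by (intro threshold_equation_iff) simp
  have "(\<forall>x y. nu_bar a b c \<le> x \<longrightarrow> x < y \<longrightarrow> ?T x < ?T y) \<and> (\<exists>\<rho>>nu_bar a b c. ?T \<rho> = 0)"
    using ab \<nu> Q
  proof (cases rule: parameter_cases)
    case nonneg_coeffs
    have "\<exists>\<rho>>nu_bar a b c. ?T \<rho> = 0"
    proof (cases "c = 0")
      case True
      thus ?thesis using threshold_root_exists_nonneg[of a b] nonneg_coeffs by simp
    next
      case False
      then obtain \<mu> where "\<mu> > nu_bar a b c" "threshold_equation a b c \<mu>"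
        using ex nonneg_coeffs by auto
      thus ?thesis using eq[of \<mu>] by auto
    qed
    thus ?thesis using threshold_strict_mono_nonneg[of a b] nonneg_coeffs by auto
  next
    case (two_roots s)
    thus ?thesis using threshold_root_exists_two_roots[of a b s] threshold_strict_mono_two_roots[of a b s] by auto
  qed
  then obtain \<rho> where mono: "\<And>x y. nu_bar a b c \<le> x \<Longrightarrow> x < y \<Longrightarrow> ?T x < ?T y"
    and \<rho>: "\<rho> > nu_bar a b c" "?T \<rho> = 0" by blast
  show thesis
  proof (rule that[OF \<rho>(1)])
    show "threshold_equation a b c \<rho>" using eq[of \<rho>] \<rho> by simp
    show "\<mu> = \<rho>" if "\<mu> > nu_bar a b c" "threshold_equation a b c \<mu>" for \<mu>
      using mono[of \<mu> \<rho>] mono[of \<rho> \<mu>] \<rho> eq[of \<mu>] that by (cases \<mu> \<rho> rule: linorder_cases) auto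
    show "\<nu> \<ge> \<rho> \<longleftrightarrow> ?T \<nu> \<ge> 0"
      using mono[of \<nu> \<rho>] mono[of \<rho> \<nu>] \<rho> \<nu> by (cases \<nu> \<rho> rule: linorder_cases) auto
  qed
qed

theorem theorem6:
  fixes a b c \<nu> :: real
  assumes "(c = 0 \<and> b \<noteq> a) \<or> (c > 0 \<and> b > a)"
    and "\<nu> \<ge> nu_bar a b c"
    and "Q_poly a b c \<nu> + 4 * a * \<nu> + 2 * a + 2 * b > 0"
    and "(4 * \<nu> + 3) * Q_poly a b c \<nu> > 4 * a * \<nu> + 2 * a + 2 * b"
    and "c > 0 \<Longrightarrow> \<exists>\<mu>>nu_bar a b c. threshold_equation a b c \<mu>"
  shows "\<exists>\<rho>>nu_bar a b c. threshold_equation a b c \<rho> \<and>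
           (\<forall>\<mu>>nu_bar a b c. threshold_equation a b c \<mu> \<longrightarrow> \<mu> = \<rho>) \<and>
           (starlike_in_disk (bessel_combination a b c \<nu>) \<and>
            (\<forall>k\<ge>1. close_to_convex_in_disk ((deriv ^^ k) (bessel_combination a b c \<nu>)))
            \<longleftrightarrow> \<nu> \<ge> \<rho>) \<and>
           (\<forall>k\<ge>1. close_to_convex_in_disk ((deriv ^^ k) (bessel_combination a b c \<nu>)) \<longrightarrow>
              inj_on ((deriv ^^ k) (bessel_combination a b c \<nu>)) (ball 0 1))"
proof -
  let ?Q = "Q_poly a b c \<nu>"
  have nu: "0 \<le> \<nu>" using assms(2) nu_bar_nonneg[of a b c] by linarith
  \<comment> \<open>The third hypothesis says that \<open>Q(\<nu> + 2) > 0\<close>, and with this identity the fourth one becomes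
  \<open>Q(\<nu> + 2) < 4 (\<nu> + 1) Q(\<nu>)\<close>; together they force \<open>Q(\<nu>) > 0\<close>.\<close>
  have Q2: "Q_poly a b c (2 + \<nu>) = ?Q + 4 * a * \<nu> + 2 * a + 2 * b"
    by (simp add: Q_poly_def algebra_simps)
  hence lt: "Q_poly a b c (2 + \<nu>) < 4 * (\<nu> + 1) * ?Q"
    using assms(4) by (simp add: algebra_simps)
  have "0 < 4 * (\<nu> + 1) * ?Q" using lt assms(3) Q2 by linarith
  hence Q: "?Q > 0" using nu by (simp add: zero_less_mult_iff)
  have adm: "admissible a b c \<nu>" by (rule admissibleI[OF assms(1,2) Q])
  have c1: "combination_coeff a b c \<nu> 1 < 1"
    using lt Q nu by (simp add: combination_coeff_def j_coeff_def divide_simps mult_ac)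
  let ?t = "(2 - bessel_ratio \<nu>) * threshold_fun a b c bessel_ratio \<nu> * j_one \<nu> / (2 * ?Q)"
  have t: "eval_fps (combination_fps a b c \<nu>) 1 + eval_fps (fps_deriv (combination_fps a b c \<nu>)) 1 = of_real ?t"
    using combination_fps_at_one[OF nu, of a b c] Q by simp
  have t_sign: "0 \<le> ?t \<longleftrightarrow> 0 \<le> threshold_fun a b c bessel_ratio \<nu>"
  proof -
    have "2 - bessel_ratio \<nu> > 0" "j_one \<nu> > 0" using q_le[OF nu] j_one(2)[OF nu] by auto
    thus ?thesis using Q by (simp add: zero_le_divide_iff zero_le_mult_iff)
  qed
  obtain \<rho> where \<rho>: "\<rho> > nu_bar a b c" "threshold_equation a b c \<rho>"
    "\<And>\<mu>. \<mu> > nu_bar a b c \<Longrightarrow> threshold_equation a b c \<mu> \<Longrightarrow> \<mu> = \<rho>"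
    "\<nu> \<ge> \<rho> \<longleftrightarrow> threshold_fun a b c bessel_ratio \<nu> \<ge> 0"
    using threshold_root[OF assms(1,2) Q assms(5)] by blast
  have "starlike_in_disk (bessel_combination a b c \<nu>) \<longleftrightarrow> \<nu> \<ge> \<rho>"
    using starlike_bessel_combination_if[OF adm c1 t] nonneg_if_starlike_bessel_combination[OF adm t]
    unfolding t_sign \<rho>(4) by blast
  thus ?thesis using \<rho> derivatives_close_to_convex[OF adm] by blast
qed

end
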